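(* Let $\sigma=\tilde\cup_i\sigma_i\subset\mathbb{R}^2$ be a self-distancing set with a finite or countable ordered family of closed connected components $\sigma_1,\sigma_2,\ldots$, and let $\sigma^{(i)}=\bigcup_{j=1}^i\sigma_j$. Let $x_i^-$ and $x_i^+$ be the first and last point of $\sigma_i$. Assume that for every $i\ge1$ for which $\sigma_{i+1}$ exists: (1) if $\sigma_{i+1}$ is not a single point (so that it is a steepest descent curve), then $\bigcup_{j=1}^i\sigma_j\subset\mathfrak{H}(\sigma_{i+1},x_{i+1}^-)$; (2) $x_{i+1}^-\in x_i^++N_{\mathrm{co}(\sigma^{(i)})}(x_i^+)$. Then there exists a steepest descent curve extending $\sigma$ (i.e. $\Gamma_\sigma\ne\emptyset$), and the curve $\overline\gamma$ obtained by connecting, in order, $\sigma_i$ and $\sigma_{i+1}$ with the segments $x_i^+x_{i+1}^-$ is a steepest descent curve and has minimal length in $\Gamma_\sigma$.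
   Context: A self-distancing set is a bounded set $\sigma\subset\mathbb{R}^2$ linearly ordered by $\preceq$ such that $x_1\preceq x_2\preceq x_3$ in $\sigma$ implies $|x_2-x_1|\le|x_3-x_1|$. A steepest descent curve (SDC) is a closed connected self-distancing set not reduced to a point (such a set is known to be a rectifiable curve oriented by $\preceq$). $\Gamma_\sigma$ is the family of SDC $\gamma\supset\sigma$ whose order extends that of $\sigma$. The notation $\sigma=\tilde\cup_i\sigma_i$ means that $\sigma$ is a self-distancing set whose closed connected components form a finite or countable family ordered as the points of $\sigma$: $i<j$, $x\in\sigma_i$, $y\in\sigma_j$ imply $x\preceq y$. $\mathrm{co}$ is the convex hull. For a convex body $K$ and $q\in K$, $N_K(q)=\{x\in\mathbb{R}^2:\langle x,y-q\rangle\le0\ \forall y\in K\}$ is the normal cone. For an SDC $\gamma$ with absolutely continuous (e.g. arc-length) parametrization $t\mapsto x(t)$ and $x_1\in\gamma$, $\mathfrak{H}(\gamma,x_1)=\bigcap_{x_1\preceq x(t)}\{y\in\mathbb{R}^2:\langle\dot x(t),y-x(t)\rangle\le0\}$, the intersection being over the $t$ at which $\dot x(t)$ is defined.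
   Formalization: The claim on the joined curve is made for σ not empty and not a single point (else it is not a steepest descent curve), and for infinitely many components the closure of the union of components and segments is taken, adding the limit end point. *)

theory Defs
  imports "HOL-Analysis.Analysis"
begin

type_synonym plane = "real ^ 2"

text \<open>The order is part of the data: an ordered set is a pair of a carrier and a relation \<open>r\<close>,
  where \<open>(x, y) \<in> r\<close> means that \<open>x\<close> precedes or equals \<open>y\<close>.\<close>

definition self_distancing :: "plane set \<Rightarrow> plane rel \<Rightarrow> bool" where
  "self_distancing A r \<longleftrightarrow>
     bounded A \<and> linear_order_on A r \<and>
     (\<forall>x\<^sub>1 x\<^sub>2 x\<^sub>3. (x\<^sub>1, x\<^sub>2) \<in> r \<and> (x\<^sub>2, x\<^sub>3) \<in> r \<longrightarrow> norm (x\<^sub>2 - x\<^sub>1) \<le> norm (x\<^sub>3 - x\<^sub>1))"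

definition sdc :: "plane set \<Rightarrow> plane rel \<Rightarrow> bool" where
  "sdc \<gamma> s \<longleftrightarrow> self_distancing \<gamma> s \<and> closed \<gamma> \<and> connected \<gamma> \<and> (\<nexists>p. \<gamma> \<subseteq> {p})"

text \<open>Between linear orders, \<open>r \<subseteq> s\<close> says exactly that \<open>s\<close> extends \<open>r\<close>.\<close>

definition sdc_extensions :: "plane set \<Rightarrow> plane rel \<Rightarrow> (plane set \<times> plane rel) set" where
  "sdc_extensions \<sigma> r = {(\<gamma>, s). sdc \<gamma> s \<and> \<sigma> \<subseteq> \<gamma> \<and> r \<subseteq> s}"

definition first_point :: "plane rel \<Rightarrow> plane set \<Rightarrow> plane" where
  "first_point r A = (THE x. x \<in> A \<and> (\<forall>y\<in>A. (x, y) \<in> r))"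

definition last_point :: "plane rel \<Rightarrow> plane set \<Rightarrow> plane" where
  "last_point r A = (THE x. x \<in> A \<and> (\<forall>y\<in>A. (y, x) \<in> r))"

text \<open>The family is indexed from 1: by \<open>1, \<dots>, N\<close> if \<open>N\<close> is finite, by all positive naturals
  if \<open>N = \<infinity>\<close>.\<close>

definition index_set :: "enat \<Rightarrow> nat set" where
  "index_set N = {i. 1 \<le> i \<and> enat i \<le> N}"

definition ordered_components ::
  "plane set \<Rightarrow> plane rel \<Rightarrow> enat \<Rightarrow> (nat \<Rightarrow> plane set) \<Rightarrow> bool" where
  "ordered_components \<sigma> r N S \<longleftrightarrow>
     self_distancing \<sigma> r \<and>
     bij_betw S (index_set N) (components \<sigma>) \<and>
     (\<forall>i\<in>index_set N. closed (S i)) \<and>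
     (\<forall>i\<in>index_set N. \<forall>j\<in>index_set N. i < j \<longrightarrow> (\<forall>x\<in>S i. \<forall>y\<in>S j. (x, y) \<in> r))"

text \<open>Length as the supremum of the lengths of inscribed polygons with vertices taken in order.\<close>

definition curve_length :: "plane rel \<Rightarrow> plane set \<Rightarrow> ennreal" where
  "curve_length r A =
     (SUP xs\<in>{xs. set xs \<subseteq> A \<and> sorted_wrt (\<lambda>x y. (x, y) \<in> r) xs}.
        ennreal (\<Sum>k<length xs - 1. norm (xs ! Suc k - xs ! k)))"

text \<open>The arc-length parametrization: the point of \<open>\<gamma>\<close> up to which \<open>\<gamma>\<close> has length \<open>t\<close>, for
  \<open>t\<close> between 0 and the length of \<open>\<gamma>\<close> (which is finite for a steepest descent curve).\<close>

definition arclength_param :: "plane rel \<Rightarrow> plane set \<Rightarrow> real \<Rightarrow> plane" where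
  "arclength_param r \<gamma> t =
     (THE p. p \<in> \<gamma> \<and> curve_length r {q \<in> \<gamma>. (q, p) \<in> r} = ennreal t)"

text \<open>The set \<open>\<HH>(\<gamma>, x\<^sub>1)\<close>. Every absolutely continuous parametrization compatible with the
  order gives the same set, since membership of \<open>y\<close> means that the distance from \<open>y\<close> is
  nondecreasing along \<open>\<gamma>\<close> from \<open>x\<^sub>1\<close> on. For the same reason it does not matter that the
  derivatives at the two end points are one-sided.\<close>

definition \<HH> :: "plane rel \<Rightarrow> plane set \<Rightarrow> plane \<Rightarrow> plane set" where
  "\<HH> r \<gamma> x\<^sub>1 =
     (let x = arclength_param r \<gamma>; T = {0..enn2real (curve_length r \<gamma>)} in
      {y. \<forall>t\<in>T. \<forall>v. (x\<^sub>1, x t) \<in> r \<and> (x has_vector_derivative v) (at t within T) \<longrightarrow>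
            v \<bullet> (y - x t) \<le> 0})"

definition normal_cone :: "plane set \<Rightarrow> plane \<Rightarrow> plane set" where
  "normal_cone K q = {x. \<forall>y\<in>K. x \<bullet> (y - q) \<le> 0}"

text \<open>For infinitely many components the union of components and segments is not closed: it
  lacks the limit of the points \<open>x\<^sub>i\<^sup>+\<close>, which is added as end point by the closure. For
  finitely many components the closure has no effect.\<close>

definition joined_curve :: "plane rel \<Rightarrow> enat \<Rightarrow> (nat \<Rightarrow> plane set) \<Rightarrow> plane set" where
  "joined_curve r N S =
     closure ((\<Union>i\<in>index_set N. S i) \<union>
              (\<Union>i\<in>{i \<in> index_set N. Suc i \<in> index_set N}.
                 closed_segment (last_point r (S i)) (first_point r (S (Suc i)))))"

definition runs_along_segment :: "plane rel \<Rightarrow> plane \<Rightarrow> plane \<Rightarrow> bool" where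
  "runs_along_segment s a b \<longleftrightarrow>
     (\<forall>x\<in>closed_segment a b. \<forall>y\<in>closed_segment a b. (x, y) \<in> s \<longleftrightarrow> norm (x - a) \<le> norm (y - a))"

end

theory Submission
  imports Defs
begin

text \<open>
  Let \<open>q\<^sub>i\<close> be the last point of \<open>\<sigma>\<^sub>i\<close> and \<open>p\<^sub>i\<^sub>+\<^sub>1\<close> the first point of \<open>\<sigma>\<^sub>i\<^sub>+\<^sub>1\<close>. The joined curve is
  built in stages \<open>\<sigma>\<^sub>1 \<subseteq> \<sigma>\<^sub>1 \<union> [q\<^sub>1, p\<^sub>2] \<union> \<sigma>\<^sub>2 \<subseteq> \<dots>\<close>. Two self-distancing pieces that share one point,
  the last of the first piece and the first of the second, may be put together as soon as the
  distance from every point of the first piece is nondecreasing along the second one (locale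
  \<open>gluable\<close>). Both hypotheses are of this kind. Every stage lies in the convex hull \<open>K\<close> of
  \<open>\<sigma>\<^sup>(\<^sup>i\<^sup>)\<close>, and \<open>p\<^sub>i\<^sub>+\<^sub>1 - q\<^sub>i \<in> N\<^sub>K(q\<^sub>i)\<close> gives that the distance from every point of \<open>K\<close> is nondecreasing
  along the segment \<open>[q\<^sub>i, p\<^sub>i\<^sub>+\<^sub>1]\<close>. Membership of \<open>\<sigma>\<^sup>(\<^sup>i\<^sup>)\<close> in \<open>\<HH>\<close> gives that the distance from every
  point of \<open>\<sigma>\<^sup>(\<^sup>i\<^sup>)\<close> is nondecreasing along \<open>\<sigma>\<^sub>i\<^sub>+\<^sub>1\<close>; the condition on a point to be
  no farther from \<open>x\<close> than from \<open>y\<close> is convex, so this extends to the convex hull of \<open>\<sigma>\<^sup>(\<^sup>i\<^sup>)\<close> and \<open>p\<^sub>i\<^sub>+\<^sub>1\<close>, which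
  contains the new segment.

  The union of the stages is then self-distancing. If there are infinitely many components it
  need not be closed, but its closure has at most one further point: with two of them, \<open>z\<close> and \<open>w\<close>,
  there would be points \<open>x\<^sub>1 \<preceq> x\<^sub>2 \<preceq> x\<^sub>3\<close> of the curve with \<open>x\<^sub>1\<close>, \<open>x\<^sub>3\<close> near \<open>z\<close> and \<open>x\<^sub>2\<close> near \<open>w\<close>.
  The new point is put at the end of the order.

  For minimality, length is additive under gluing, so a stage is as long as the components in it
  together with the gaps between them, and this is at most the supremum of the lengths of the
  polygons with vertices in \<open>\<sigma>\<close>. Hence the joined curve is no longer than
  \<open>curve_length r \<sigma>\<close>, and every curve that extends \<open>\<sigma>\<close> is at least that long because the same
  polygons are inscribed in it.

  The main work is the interpretation of \<open>\<HH>\<close>, which is defined by derivatives of the arc-length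
  parametrization. It rests on two facts. First, a self-distancing set in the plane has finite
  length (\<open>polygon_lengths_bounded\<close>): in finitely many fixed directions the extent of the visited
  set can only grow, and each step of a polygon increases it in one of them by at least half the length
  of the step. Then the length up to a point is a continuous strictly increasing
  function on a compact connected piece, and its inverse, the arc-length parametrization, is
  1-Lipschitz. Second, a Lipschitz curve is differentiable almost everywhere
  (\<open>negligible_nondifferentiable_lipschitz\<close>), and a Lipschitz function whose derivative is
  nonnegative almost everywhere is nondecreasing (\<open>ae_nondecreasing_imp_le\<close>); the latter is
  applied to the squared distance from a point of \<open>\<HH>\<close>.
\<close>

section \<open>Lipschitz curves are differentiable almost everywhere\<close>

lemma cball_real_interval: "a \<le> b \<Longrightarrow> cball ((a + b) / 2) ((b - a) / 2) = {a..b::real}"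
  by (auto simp: cball_def dist_real_def abs_if field_simps)

text \<open>Vitali's covering theorem for balls, read for intervals. The points need not be the centres
  of the intervals that contain them, which allows intervals with the point as an end point.\<close>
lemma fine_interval_cover:
  fixes E :: "real set" and K :: "(real \<times> real) set"
  assumes lt: "\<And>a b. (a, b) \<in> K \<Longrightarrow> a < b"
    and fine: "\<And>t d. \<lbrakk>t \<in> E; d > 0\<rbrakk> \<Longrightarrow> \<exists>a b. (a, b) \<in> K \<and> a \<le> t \<and> t \<le> b \<and> b - a < d"
  obtains C where "countable C" "C \<subseteq> K" "disjoint_family_on (\<lambda>i. {fst i..snd i}) C"
    "negligible (E - (\<Union>i\<in>C. {fst i..snd i}))"
proof -
  let ?c = "\<lambda>i::real\<times>real. (fst i + snd i) / 2" and ?r = "\<lambda>i::real\<times>real. (snd i - fst i) / 2"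
  have ball: "cball (?c i) (?r i) = {fst i..snd i}" if "i \<in> K" for i
    using lt[of "fst i" "snd i"] that by (intro cball_real_interval) auto
  obtain C where C: "countable C" "C \<subseteq> K"
     "pairwise (\<lambda>i j. disjnt (cball (?c i) (?r i)) (cball (?c j) (?r j))) C"
     "negligible (E - (\<Union>i\<in>C. cball (?c i) (?r i)))"
  proof (rule Vitali_covering_theorem_cballs[of K ?r E ?c])
    show "0 < ?r i" if "i \<in> K" for i using lt[of "fst i" "snd i"] that by auto
    show "\<exists>i. i \<in> K \<and> x \<in> cball (?c i) (?r i) \<and> ?r i < d" if xd: "x \<in> E" "0 < d" for x d
    proof -
      obtain a b where ab: "(a, b) \<in> K" "a \<le> x" "x \<le> b" "b - a < d" using fine[OF xd] by blast
      then have "x \<in> cball (?c (a, b)) (?r (a, b))" using ball[of "(a, b)"] by auto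
      moreover have "?r (a, b) < d" using ab lt[of a b] by auto
      ultimately show ?thesis using ab(1) by blast
    qed
  qed auto
  have "pairwise (\<lambda>i j. disjnt {fst i..snd i} {fst j..snd j}) C"
    using C(3) ball subsetD[OF C(2)] by (simp add: pairwise_def)
  then have "disjoint_family_on (\<lambda>i. {fst i..snd i}) C"
    unfolding disjoint_family_on_def pairwise_def disjnt_def by auto
  moreover have "(\<Union>i\<in>C. cball (?c i) (?r i)) = (\<Union>i\<in>C. {fst i..snd i})"
    using C(2) ball by (intro SUP_cong) auto
  ultimately show ?thesis using C that by metis
qed

text \<open>The Stieltjes measure of \<open>g\<close> gives \<open>{a..b}\<close> the mass \<open>g b - g a\<close>, so countable additivity turns a
  common bound on the slopes of disjoint intervals into a comparison with Lebesgue measure.\<close>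
lemma stieltjes_of_intervals:
  fixes g :: "real \<Rightarrow> real" and C :: "(real \<times> real) set"
  assumes g: "mono g" "continuous_on UNIV g"
    and C: "countable C" "disjoint_family_on (\<lambda>i. {fst i..snd i}) C" "\<And>i. i \<in> C \<Longrightarrow> fst i < snd i"
    and p: "p \<ge> 0"
  shows "(\<And>i. i \<in> C \<Longrightarrow> g (snd i) - g (fst i) \<le> p * (snd i - fst i)) \<Longrightarrow>
      emeasure (interval_measure g) (\<Union>i\<in>C. {fst i..snd i}) \<le> ennreal p * emeasure lborel (\<Union>i\<in>C. {fst i..snd i})"
    and "(\<And>i. i \<in> C \<Longrightarrow> g (snd i) - g (fst i) \<ge> p * (snd i - fst i)) \<Longrightarrow>
      emeasure (interval_measure g) (\<Union>i\<in>C. {fst i..snd i}) \<ge> ennreal p * emeasure lborel (\<Union>i\<in>C. {fst i..snd i})"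
proof -
  let ?X = "\<lambda>i::real\<times>real. {fst i..snd i}"
  have nu: "emeasure (interval_measure g) (?X i) = ennreal (g (snd i) - g (fst i))" if "i \<in> C" for i
    using C(3)[OF that] g by (intro emeasure_interval_measure_Icc) (auto simp: mono_def)
  have lb: "ennreal p * emeasure lborel (?X i) = ennreal (p * (snd i - fst i))" if "i \<in> C" for i
    using C(3)[OF that] p by (simp add: ennreal_mult)
  have 1: "emeasure (interval_measure g) (\<Union>i\<in>C. ?X i) =
      (\<integral>\<^sup>+ i. emeasure (interval_measure g) (?X i) \<partial>count_space C)"
    using C by (intro emeasure_UN_countable) auto
  have "emeasure lborel (\<Union>i\<in>C. ?X i) = (\<integral>\<^sup>+ i. emeasure lborel (?X i) \<partial>count_space C)"
    using C by (intro emeasure_UN_countable) auto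
  then have 2: "ennreal p * emeasure lborel (\<Union>i\<in>C. ?X i) =
      (\<integral>\<^sup>+ i. ennreal p * emeasure lborel (?X i) \<partial>count_space C)"
    by (simp add: nn_integral_cmult)
  show "emeasure (interval_measure g) (\<Union>i\<in>C. ?X i) \<le> ennreal p * emeasure lborel (\<Union>i\<in>C. ?X i)"
    if "\<And>i. i \<in> C \<Longrightarrow> g (snd i) - g (fst i) \<le> p * (snd i - fst i)"
    unfolding 1 2 by (rule nn_integral_mono) (auto simp: nu lb intro!: ennreal_leI that simp del: emeasure_lborel_Icc)
  show "emeasure (interval_measure g) (\<Union>i\<in>C. ?X i) \<ge> ennreal p * emeasure lborel (\<Union>i\<in>C. ?X i)"
    if "\<And>i. i \<in> C \<Longrightarrow> g (snd i) - g (fst i) \<ge> p * (snd i - fst i)"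
    unfolding 1 2 by (rule nn_integral_mono) (auto simp: nu lb intro!: ennreal_leI that simp del: emeasure_lborel_Icc)
qed

text \<open>Let \<open>m\<close> be the outer measure of \<open>E\<close>. Almost all of \<open>E\<close> is covered by disjoint intervals of
  slope at most \<open>p\<close> inside an open set of measure less than \<open>m + 2 * e\<close>, and again by disjoint intervals of slope at
  least \<open>q\<close> inside the former ones. Comparing the Stieltjes masses of the two unions gives
  \<open>q * m \<le> p * (m + 2 * e)\<close> for the chosen \<open>e\<close>, which is impossible if \<open>m > 0\<close>.\<close>
lemma negligible_contrasting_slopes:
  fixes g :: "real \<Rightarrow> real"
  assumes g: "mono g" "continuous_on UNIV g" and E: "bounded E" and pq: "0 \<le> p" "p < q"
    and lo: "\<And>t d. \<lbrakk>t \<in> E; d > 0\<rbrakk> \<Longrightarrow>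
      \<exists>a b. a < b \<and> a \<le> t \<and> t \<le> b \<and> b - a < d \<and> g b - g a \<le> p * (b - a)"
    and hi: "\<And>t d. \<lbrakk>t \<in> E; d > 0\<rbrakk> \<Longrightarrow>
      \<exists>a b. a < b \<and> a \<le> t \<and> t \<le> b \<and> b - a < d \<and> g b - g a \<ge> q * (b - a)"
  shows "negligible E"
proof (rule ccontr)
  assume notneg: "\<not> negligible E"
  let ?\<mu> = "measure lebesgue"
  define m where "m = Inf {?\<mu> V |V. V \<in> lmeasurable \<and> E \<subseteq> V}"
  obtain R where "\<And>t. t \<in> E \<Longrightarrow> norm t \<le> R" using E bounded_iff by blast
  then have R: "E \<subseteq> cball 0 R" by auto
  have ne: "{?\<mu> V |V. V \<in> lmeasurable \<and> E \<subseteq> V} \<noteq> {}" using R lmeasurable_cball by blast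
  have bdd: "bdd_below {?\<mu> V |V. V \<in> lmeasurable \<and> E \<subseteq> V}" by (rule bdd_belowI[of _ 0]) auto
  have m_le: "m \<le> ?\<mu> V" if "V \<in> lmeasurable" "E \<subseteq> V" for V
    unfolding m_def by (rule cInf_lower[OF _ bdd]) (use that in blast)
  have approx: "\<exists>V. V \<in> lmeasurable \<and> E \<subseteq> V \<and> ?\<mu> V < m + e" if "e > 0" for e
    using cInf_lessD[OF ne, of "m + e"] that unfolding m_def by auto
  have "m \<ge> 0" unfolding m_def using ne by (rule cInf_greatest) auto
  moreover have "m \<noteq> 0" using notneg approx unfolding negligible_outer by (metis add_0)
  ultimately have m: "m > 0" by simp
  \<comment> \<open>chosen so that \<open>2 * p * e < (q - p) * m\<close>\<close>
  define e where "e = (q - p) * m / (4 * (p + 1))"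
  have e: "e > 0" using m pq unfolding e_def by simp
  obtain V where V: "V \<in> lmeasurable" "E \<subseteq> V" "?\<mu> V < m + e" using approx[OF e] by blast
  obtain U where U: "open U" "V \<subseteq> U" "U - V \<in> lmeasurable" "emeasure lebesgue (U - V) < ennreal e"
    using sets_lebesgue_outer_open[of V e] V e by (metis fmeasurableD)
  have Ulm: "U \<in> lmeasurable"
    using fmeasurable.Un[OF V(1) U(3)] U(2) by (simp add: Un_absorb1)
  have "?\<mu> (U - V) < e"
    using U(4) emeasure_eq_measure2[OF U(3)] by (simp add: ennreal_less_iff)
  then have muU: "?\<mu> U < m + 2 * e"
    using V(3) measurable_measure_Diff[OF Ulm _ U(2)] V(1) by auto
  define K where "K = {(a, b). a < b \<and> {a..b} \<subseteq> U \<and> g b - g a \<le> p * (b - a)}"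
  have fits: "\<exists>d'>0. \<forall>a b. a \<le> t \<and> t \<le> b \<and> b - a < d' \<longrightarrow> {a..b} \<subseteq> W" if oW: "open W" "t \<in> W" for t :: real and W
  proof -
    obtain d' where d': "d' > 0" "ball t d' \<subseteq> W" using oW open_contains_ball by blast
    have "{a..b} \<subseteq> W" if "a \<le> t" "t \<le> b" "b - a < d'" for a b
    proof -
      have "{a..b} \<subseteq> ball t d'" using that by (auto simp: dist_real_def)
      then show ?thesis using d'(2) by (rule order_trans)
    qed
    then show ?thesis using d'(1) by (intro exI[of _ d']) simp
  qed
  obtain C where C: "countable C" "C \<subseteq> K" "disjoint_family_on (\<lambda>i. {fst i..snd i}) C"
    "negligible (E - (\<Union>i\<in>C. {fst i..snd i}))"
  proof (rule fine_interval_cover[of K E])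
    fix t d :: real assume t: "t \<in> E" "d > 0"
    then have "t \<in> U" using V(2) U(2) by blast
    obtain d' where "d' > 0" "\<forall>a b. a \<le> t \<and> t \<le> b \<and> b - a < d' \<longrightarrow> {a..b} \<subseteq> U"
      using fits[OF U(1) \<open>t \<in> U\<close>] by (elim exE conjE) (rule that)
    moreover obtain a b where "a < b \<and> a \<le> t \<and> t \<le> b \<and> b - a < min d d' \<and> g b - g a \<le> p * (b - a)"
      using lo[OF t(1), of "min d d'"] t(2) \<open>d' > 0\<close> by auto
    ultimately show "\<exists>a b. (a, b) \<in> K \<and> a \<le> t \<and> t \<le> b \<and> b - a < d"
      unfolding K_def by (intro exI[of _ a] exI[of _ b]) auto
  qed (auto simp: K_def)
  \<comment> \<open>Open intervals leave room for the second family; only countably many points are lost.\<close>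
  define W where "W = (\<Union>i\<in>C. {fst i<..<snd i})"
  have W: "open W" unfolding W_def by auto
  have "E - W \<subseteq> (E - (\<Union>i\<in>C. {fst i..snd i})) \<union> (\<Union>i\<in>C. {fst i, snd i})"
  proof
    fix t assume t: "t \<in> E - W"
    show "t \<in> (E - (\<Union>i\<in>C. {fst i..snd i})) \<union> (\<Union>i\<in>C. {fst i, snd i})"
    proof (cases "\<exists>i\<in>C. t \<in> {fst i..snd i}")
      case True
      then obtain i where i: "i \<in> C" "t \<in> {fst i..snd i}" by blast
      moreover have "t \<notin> {fst i<..<snd i}" using t i(1) unfolding W_def by blast
      ultimately have "t \<in> {fst i, snd i}" by auto
      then show ?thesis using i(1) by blast
    qed (use t in blast)
  qed
  moreover have "negligible (\<Union>i\<in>C. {fst i, snd i})"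
    using C(1) by (intro negligible_countable_Union) (auto intro: negligible_finite)
  ultimately have negW: "negligible (E - W)"
    using C(4) negligible_Un negligible_subset by blast
  define K' where "K' = {(a, b). a < b \<and> {a..b} \<subseteq> W \<and> g b - g a \<ge> q * (b - a)}"
  obtain C' where C': "countable C'" "C' \<subseteq> K'" "disjoint_family_on (\<lambda>i. {fst i..snd i}) C'"
    "negligible (E \<inter> W - (\<Union>i\<in>C'. {fst i..snd i}))"
  proof (rule fine_interval_cover[of K' "E \<inter> W"])
    fix t d :: real assume t: "t \<in> E \<inter> W" "d > 0"
    obtain d' where "d' > 0" "\<forall>a b. a \<le> t \<and> t \<le> b \<and> b - a < d' \<longrightarrow> {a..b} \<subseteq> W"
      using fits[OF W, of t] t by (elim IntE) (meson)
    moreover obtain a b where "a < b \<and> a \<le> t \<and> t \<le> b \<and> b - a < min d d' \<and> g b - g a \<ge> q * (b - a)"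
      using hi[of t "min d d'"] t \<open>d' > 0\<close> by auto
    ultimately show "\<exists>a b. (a, b) \<in> K' \<and> a \<le> t \<and> t \<le> b \<and> b - a < d"
      unfolding K'_def by (intro exI[of _ a] exI[of _ b]) auto
  qed (auto simp: K'_def)
  let ?D = "\<Union>i\<in>C. {fst i..snd i}" and ?D' = "\<Union>i\<in>C'. {fst i..snd i}"
  have Ci: "{fst i..snd i} \<subseteq> U" "fst i < snd i" "g (snd i) - g (fst i) \<le> p * (snd i - fst i)" if "i \<in> C" for i
    using subsetD[OF C(2) that] by (auto simp: K_def case_prod_beta)
  have C'i: "{fst i..snd i} \<subseteq> W" "fst i < snd i" "g (snd i) - g (fst i) \<ge> q * (snd i - fst i)" if "i \<in> C'" for i
    using subsetD[OF C'(2) that] by (auto simp: K'_def case_prod_beta)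
  have DU: "?D \<subseteq> U" using Ci(1) by (rule UN_least)
  have D'D: "?D' \<subseteq> ?D"
  proof -
    have "?D' \<subseteq> W" using C'i(1) by (rule UN_least)
    also have "W \<subseteq> ?D" unfolding W_def by (intro UN_mono) auto
    finally show ?thesis .
  qed
  have Db: "?D \<in> sets borel" "?D' \<in> sets borel" using C(1) C'(1) by auto
  have Dlm: "?D \<in> lmeasurable" "?D' \<in> lmeasurable"
    using fmeasurableI2[OF Ulm DU] fmeasurableI2[OF Ulm order_trans[OF D'D DU]] Db by simp_all
  define Z where "Z = (E - W) \<union> (E \<inter> W - ?D')"
  have Z: "negligible Z" unfolding Z_def using negW C'(4) negligible_Un by blast
  have "E \<subseteq> ?D' \<union> Z" unfolding Z_def by blast
  then have "m \<le> ?\<mu> (?D' \<union> Z)"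
    by (intro m_le fmeasurable.Un Dlm negligible_imp_measurable Z)
  also have "\<dots> \<le> ?\<mu> ?D' + ?\<mu> Z"
    using Dlm(2) Z by (intro measure_Un_le) (auto simp: negligible_imp_sets)
  finally have mD': "m \<le> ?\<mu> ?D'" using Z negligible_imp_measure0 by fastforce
  have em: "emeasure lborel A = ennreal (?\<mu> A)" if "A \<in> lmeasurable" "A \<in> sets borel" for A :: "real set"
    using emeasure_eq_measure2[OF that(1)] that(2) by simp
  have "ennreal q * emeasure lborel ?D' \<le> emeasure (interval_measure g) ?D'"
    using C'(1,3) C'i pq by (intro stieltjes_of_intervals(2) g) auto
  also have "\<dots> \<le> emeasure (interval_measure g) ?D"
    using D'D Db by (intro emeasure_mono) auto
  also have "\<dots> \<le> ennreal p * emeasure lborel ?D"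
    using C(1,3) Ci pq by (intro stieltjes_of_intervals(1) g) auto
  finally have "ennreal (q * ?\<mu> ?D') \<le> ennreal (p * ?\<mu> ?D)"
    using em Dlm Db pq by (simp add: ennreal_mult)
  then have "q * ?\<mu> ?D' \<le> p * ?\<mu> ?D" using pq by (simp add: ennreal_le_iff)
  also have "\<dots> \<le> p * ?\<mu> U"
    using pq Dlm Ulm DU by (intro mult_left_mono measure_mono_fmeasurable) auto
  also have "\<dots> \<le> p * (m + 2 * e)" using muU pq by (intro mult_left_mono) auto
  finally have "q * m \<le> p * (m + 2 * e)"
    using mult_left_mono[OF mD', of q] pq by linarith
  then have "(q - p) * m \<le> 2 * p * e" by (simp add: algebra_simps)
  moreover have "(q - p) * m = 4 * (p + 1) * e" using pq unfolding e_def by simp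
  ultimately have "4 * (p + 1) * e \<le> 2 * p * e" by simp
  then have "4 * (p + 1) \<le> 2 * p" using e by (simp only: mult_le_cancel_right_pos)
  then show False using pq by simp
qed

text \<open>If the difference quotient at \<open>t\<close> has no limit, two rationals separate its lower from its upper limit,
  so \<open>t\<close> lies in one of countably many sets on which slopes below \<open>p\<close> and above \<open>q\<close>
  both occur at arbitrarily small scales.\<close>
lemma negligible_nondifferentiable_mono:
  fixes g :: "real \<Rightarrow> real"
  assumes g: "mono g" "M-lipschitz_on UNIV g"
  shows "negligible {t. \<not> g differentiable at t}"
proof -
  have cont: "continuous_on UNIV g" using g(2) lipschitz_on_continuous_on by blast
  define Q where "Q t h = (g (t + h) - g t) / h" for t h
  have Q: "0 \<le> Q t h \<and> Q t h \<le> M" for t h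
  proof -
    have "\<bar>g (t + h) - g t\<bar> \<le> M * \<bar>h\<bar>"
      using lipschitz_onD[OF g(2), of "t + h" t] by (simp add: dist_real_def)
    moreover have "M \<ge> 0" using g(2) lipschitz_on_nonneg by blast
    moreover have "h > 0 \<Longrightarrow> g (t + h) - g t \<ge> 0" "h < 0 \<Longrightarrow> g (t + h) - g t \<le> 0"
      using g(1) by (auto simp: mono_def)
    ultimately show ?thesis unfolding Q_def
      by (cases h "0::real" rule: linorder_cases) (auto simp: field_simps divide_nonpos_neg)
  qed
  define B where "B p q n = {t. (\<exists>\<^sub>F h in at 0. Q t h < p) \<and> (\<exists>\<^sub>F h in at 0. Q t h > q) \<and> \<bar>t\<bar> \<le> n}" for p q n :: real
  have itv: "\<exists>a b. a < b \<and> a \<le> t \<and> t \<le> b \<and> b - a < d \<and> P ((g b - g a) / (b - a))"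
    if "\<exists>\<^sub>F h in at 0. P (Q t h)" "d > 0" for t d P
  proof -
    have "\<exists>h. P (Q t h) \<and> h \<noteq> 0 \<and> \<bar>h\<bar> < d"
      using that unfolding frequently_def eventually_at by (auto simp: dist_real_def)
    then obtain h where h: "P (Q t h)" "h \<noteq> 0" "\<bar>h\<bar> < d" by blast
    show ?thesis
    proof (cases "h > 0")
      case True
      then show ?thesis using h by (intro exI[of _ t] exI[of _ "t + h"]) (auto simp: Q_def)
    next
      case False
      moreover have "(g t - g (t + h)) / (t - (t + h)) = Q t h"
        unfolding Q_def using h(2) by (simp add: field_simps)
      ultimately show ?thesis using h by (intro exI[of _ "t + h"] exI[of _ t]) auto
    qed
  qed
  have B: "negligible (B p q n)" if "p < q" for p q n
  proof (cases "p \<ge> 0")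
    case True
    show ?thesis
    proof (rule negligible_contrasting_slopes[OF g(1) cont _ True that])
      show "bounded (B p q n)" by (rule boundedI[of _ n]) (auto simp: B_def)
      show "\<exists>a b. a < b \<and> a \<le> t \<and> t \<le> b \<and> b - a < d \<and> g b - g a \<le> p * (b - a)"
        if "t \<in> B p q n" "d > 0" for t d
        using itv[of "\<lambda>x. x < p" t d] that unfolding B_def by (fastforce simp: field_simps)
      show "\<exists>a b. a < b \<and> a \<le> t \<and> t \<le> b \<and> b - a < d \<and> g b - g a \<ge> q * (b - a)"
        if "t \<in> B p q n" "d > 0" for t d
        using itv[of "\<lambda>x. x > q" t d] that unfolding B_def by (fastforce simp: field_simps)
    qed
  next
    case False
    then have "\<not> Q t h < p" for t h using Q[of t h] by simp
    then have "B p q n = {}" by (simp add: B_def)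
    then show ?thesis by simp
  qed
  have "{t. \<not> g differentiable at t} \<subseteq> (\<Union>(p, q, n)\<in>{(p, q, n). p \<in> \<rat> \<and> q \<in> \<rat> \<and> n \<in> \<rat> \<and> p < q}. B p q n)"
  proof
    fix t assume "t \<in> {t. \<not> g differentiable at t}"
    then have nd: "\<not> g differentiable at t" by simp
    let ?F = "at (0::real)" and ?f = "\<lambda>h. ereal (Q t h)"
    have ne: "?F \<noteq> bot" by simp
    have "Liminf ?F ?f < Limsup ?F ?f"
    proof (rule ccontr)
      assume "\<not> Liminf ?F ?f < Limsup ?F ?f"
      then have eq: "Liminf ?F ?f = Limsup ?F ?f" using Liminf_le_Limsup[OF ne, of ?f] by order
      have "Limsup ?F ?f \<le> ereal M" by (rule Limsup_bounded) (auto simp: Q)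
      moreover have "ereal 0 \<le> Liminf ?F ?f" by (rule Liminf_bounded) (auto simp: Q)
      ultimately obtain l where "Limsup ?F ?f = ereal l"
        using eq by (cases "Limsup ?F ?f") auto
      then have "(?f \<longlongrightarrow> ereal l) ?F" using eq by (intro Liminf_eq_Limsup ne) auto
      then have "(Q t \<longlongrightarrow> l) ?F" by simp
      then have "(g has_real_derivative l) (at t)" unfolding DERIV_def Q_def by simp
      then show False using nd real_differentiable_def by blast
    qed
    then obtain p' where p': "Liminf ?F ?f < ereal p'" "ereal p' < Limsup ?F ?f" using ereal_dense2 by blast
    obtain q' where q': "ereal p' < ereal q'" "ereal q' < Limsup ?F ?f" using ereal_dense2[OF p'(2)] by blast
    have "p' < q'" using q'(1) by simp
    then obtain p where p: "p \<in> \<rat>" "p' < p" "p < q'" using Rats_dense_in_real by blast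
    obtain q where q: "q \<in> \<rat>" "p < q" "q < q'" using Rats_dense_in_real[OF p(3)] by blast
    have "ereal p' < ereal p" "ereal q < ereal q'" using p q by auto
    then have "Liminf ?F ?f < ereal p" "ereal q < Limsup ?F ?f"
      using less_trans[OF p'(1)] less_trans[OF _ q'(2)] by auto
    have 1: "\<exists>\<^sub>F h in ?F. Q t h < p"
    proof (rule ccontr)
      assume "\<not> (\<exists>\<^sub>F h in ?F. Q t h < p)"
      then have "\<forall>\<^sub>F h in ?F. ereal p \<le> ?f h" by (simp add: frequently_def not_less)
      then have "ereal p \<le> Liminf ?F ?f" by (rule Liminf_bounded)
      then show False using \<open>Liminf ?F ?f < ereal p\<close> by simp
    qed
    have 2: "\<exists>\<^sub>F h in ?F. Q t h > q"
    proof (rule ccontr)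
      assume "\<not> (\<exists>\<^sub>F h in ?F. Q t h > q)"
      then have "\<forall>\<^sub>F h in ?F. ?f h \<le> ereal q" by (simp add: frequently_def not_less)
      then have "Limsup ?F ?f \<le> ereal q" by (rule Limsup_bounded)
      then show False using \<open>ereal q < Limsup ?F ?f\<close> by simp
    qed
    obtain n where "n \<in> \<rat>" "\<bar>t\<bar> \<le> n" using real_arch_simple[of "\<bar>t\<bar>"] Rats_of_nat by blast
    then have "t \<in> B p q n" using 1 2 by (simp add: B_def)
    then show "t \<in> (\<Union>(p, q, n)\<in>{(p, q, n). p \<in> \<rat> \<and> q \<in> \<rat> \<and> n \<in> \<rat> \<and> p < q}. B p q n)"
      using p q \<open>n \<in> \<rat>\<close> by blast
  qed
  moreover have "countable {(p::real, q::real, n::real). p \<in> \<rat> \<and> q \<in> \<rat> \<and> n \<in> \<rat> \<and> p < q}" (is "countable ?R")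
    by (rule countable_subset[of _ "\<rat> \<times> \<rat> \<times> \<rat>"]) (auto intro!: countable_SIGMA countable_rat)
  then have "negligible (\<Union>((\<lambda>(p, q, n). B p q n) ` ?R))"
  proof (intro negligible_countable_Union countable_image)
    fix A assume "A \<in> (\<lambda>(p, q, n). B p q n) ` ?R"
    then obtain p q n where "A = B p q n" "p < q" by auto
    then show "negligible A" using B by simp
  qed
  ultimately show ?thesis using negligible_subset by blast
qed

text \<open>Each coordinate of an \<open>M\<close>-Lipschitz curve becomes monotone when \<open>M * t\<close> is added.\<close>
lemma negligible_nondifferentiable_lipschitz:
  fixes f :: "real \<Rightarrow> 'a::euclidean_space"
  assumes f: "M-lipschitz_on UNIV f"
  shows "negligible {t. \<not> f differentiable at t}"
proof -
  have M: "M \<ge> 0" using f lipschitz_on_nonneg by blast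
  have "negligible {t. \<not> (\<lambda>t. f t \<bullet> b) differentiable at t}" if b: "b \<in> Basis" for b
  proof -
    have lip: "\<bar>f s \<bullet> b - f t \<bullet> b\<bar> \<le> M * \<bar>s - t\<bar>" for s t
    proof -
      have "\<bar>(f s - f t) \<bullet> b\<bar> \<le> norm (f s - f t)" using Basis_le_norm[OF b] by blast
      also have "\<dots> \<le> M * \<bar>s - t\<bar>"
        using lipschitz_onD[OF f, of s t] by (simp add: dist_norm)
      finally show ?thesis by (simp add: inner_diff_left)
    qed
    let ?g = "\<lambda>t. f t \<bullet> b + M * t"
    have "mono ?g"
    proof (rule monoI)
      fix s t :: real assume "s \<le> t"
      then show "?g s \<le> ?g t" using lip[of s t] by (simp add: algebra_simps abs_le_iff)
    qed
    moreover have "(2 * M)-lipschitz_on UNIV ?g"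
    proof (rule lipschitz_onI)
      fix s t :: real
      have "\<bar>(f s \<bullet> b - f t \<bullet> b) + M * (s - t)\<bar> \<le> M * \<bar>s - t\<bar> + M * \<bar>s - t\<bar>"
        using M lip[of s t] abs_triangle_ineq[of "f s \<bullet> b - f t \<bullet> b" "M * (s - t)"] by (simp add: abs_mult)
      then show "dist (?g s) (?g t) \<le> 2 * M * dist s t" by (simp add: dist_real_def algebra_simps)
    qed (use M in simp)
    ultimately have "negligible {t. \<not> ?g differentiable at t}" by (rule negligible_nondifferentiable_mono)
    moreover have "(\<lambda>t. f t \<bullet> b) differentiable at t" if "?g differentiable at t" for t
    proof -
      have "(\<lambda>t. ?g t - M * t) differentiable at t"
        using that by (intro differentiable_diff) (auto intro!: derivative_intros)
      then show ?thesis by simp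
    qed
    ultimately show ?thesis by - (erule negligible_subset, auto)
  qed
  moreover have "{t. \<not> f differentiable at t} = (\<Union>b\<in>Basis. {t. \<not> (\<lambda>t. f t \<bullet> b) differentiable at t})"
    using differentiable_componentwise_within[of f _ UNIV] by auto
  ultimately show ?thesis by (simp only:) (intro negligible_Union, auto)
qed

lemma locally_nondecreasing_imp_le:
  fixes g :: "real \<Rightarrow> real"
  assumes "a \<le> b" and g: "continuous_on {a..b} g"
    and step: "\<And>t. \<lbrakk>a \<le> t; t < b\<rbrakk> \<Longrightarrow> \<exists>d>0. \<forall>s. t < s \<and> s < t + d \<and> s \<le> b \<longrightarrow> g t \<le> g s"
  shows "g a \<le> g b"
proof -
  let ?S = "{t \<in> {a..b}. g a \<le> g t}"
  have "closed ?S" using continuous_on_closed_Collect_le[OF continuous_on_const g closed_atLeastAtMost] by simp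
  moreover have "bounded ?S" by (rule bounded_subset[of "{a..b}"]) auto
  ultimately have "compact ?S" by (simp add: compact_eq_bounded_closed)
  moreover have "a \<in> ?S" using \<open>a \<le> b\<close> by simp
  ultimately obtain c where c: "c \<in> ?S" "\<And>t. t \<in> ?S \<Longrightarrow> t \<le> c"
    using compact_attains_sup[of ?S] by blast
  have "c = b"
  proof (rule ccontr)
    assume "c \<noteq> b"
    then have "a \<le> c" "c < b" using c(1) by auto
    then obtain d where d: "d > 0" "\<forall>s. c < s \<and> s < c + d \<and> s \<le> b \<longrightarrow> g c \<le> g s" using step by blast
    let ?s = "min (c + d / 2) b"
    have s: "c < ?s" "?s < c + d" "?s \<le> b" using d(1) \<open>c < b\<close> by auto
    then have "g c \<le> g ?s" using d(2) by blast
    then have "?s \<in> ?S" using c(1) s by auto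
    then show False using c(2) s(1) by fastforce
  qed
  then show ?thesis using c(1) by simp
qed

text \<open>The exceptional null set is enclosed in an open set \<open>U\<close> of small measure, and \<open>C\<close> times the measure
  of \<open>U \<inter> {a..t}\<close> is added to \<open>f t\<close>. Inside \<open>U\<close> this term compensates any decrease
  that the Lipschitz constant allows, so the sum is locally nondecreasing at every point, while its
  total contribution is small.\<close>
lemma ae_nondecreasing_imp_le:
  fixes f :: "real \<Rightarrow> real"
  assumes ab: "a \<le> b" and lip: "C-lipschitz_on {a..b} f" and N: "negligible N"
    and step: "\<And>t e. \<lbrakk>a \<le> t; t < b; t \<notin> N; e > 0\<rbrakk> \<Longrightarrow>
      \<exists>d>0. \<forall>s. t < s \<and> s < t + d \<and> s \<le> b \<longrightarrow> f t - e * (s - t) \<le> f s"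
  shows "f a \<le> f b"
proof -
  have C: "C \<ge> 0" using lip lipschitz_on_nonneg by blast
  have lipD: "\<bar>f s - f t\<bar> \<le> C * (s - t)" if "a \<le> t" "t \<le> s" "s \<le> b" for s t
    using lipschitz_onD[OF lip, of s t] that by (simp add: dist_real_def)
  have approx: "f a \<le> f b + e * (C + (b - a))" if e: "e > 0" for e
  proof -
    obtain U where U: "open U" "N \<subseteq> U" "U - N \<in> lmeasurable" "emeasure lebesgue (U - N) < ennreal e"
      using sets_lebesgue_outer_open[of N e] N e negligible_imp_sets by metis
    have Nm: "N \<in> lmeasurable" "measure lebesgue N = 0"
      using N negligible_imp_measurable negligible_imp_measure0 by auto
    have Ulm: "U \<in> lmeasurable"
      using fmeasurable.Un[OF Nm(1) U(3)] U(2) by (simp add: Un_absorb1)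
    have "measure lebesgue (U - N) < e"
      using U(4) emeasure_eq_measure2[OF U(3)] by (simp add: ennreal_less_iff)
    then have muU: "measure lebesgue U < e"
      using measurable_measure_Diff[OF Ulm _ U(2)] Nm by (auto dest: fmeasurableD)
    define m where "m t = measure lebesgue (U \<inter> {a..t})" for t
    have Ilm: "U \<inter> A \<in> lmeasurable" if "A \<in> sets lebesgue" for A
      using Ulm that by (intro fmeasurable_Int_fmeasurable) auto
    have m_add: "m s = m t + measure lebesgue (U \<inter> {t<..s})" if "a \<le> t" "t \<le> s" for s t
    proof -
      have "U \<inter> {a..s} = (U \<inter> {a..t}) \<union> (U \<inter> {t<..s})" using that by auto
      moreover have "(U \<inter> {a..t}) \<inter> (U \<inter> {t<..s}) = {}" by auto
      ultimately show ?thesis unfolding m_def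
        using measure_Un3[OF Ilm[of "{a..t}"] Ilm[of "{t<..s}"]] by simp
    qed
    have m_le: "m s - m t \<le> s - t" "m t \<le> m s" if "a \<le> t" "t \<le> s" for s t
    proof -
      have "measure lebesgue (U \<inter> {t<..s}) \<le> measure lebesgue {t<..s}"
        using fmeasurableD[OF Ilm[of "{t<..s}"]] bounded_subset[OF bounded_closed_interval[of t s], of "{t<..s}"]
        by (intro measure_mono_fmeasurable) (auto simp: bounded_set_imp_lmeasurable)
      then show "m s - m t \<le> s - t" "m t \<le> m s" using m_add[OF that] that by auto
    qed
    have m_eq: "m s - m t = s - t" if "a \<le> t" "t \<le> s" "{t<..s} \<subseteq> U" for s t
      using m_add[OF that(1,2)] that by (simp add: Int_absorb1)
    define g where "g t = f t + C * m t + e * t" for t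
    have "g a \<le> g b"
    proof (rule locally_nondecreasing_imp_le[OF ab])
      have "1-lipschitz_on {a..b} m"
      proof (rule lipschitz_onI)
        fix s t assume "s \<in> {a..b}" "t \<in> {a..b}"
        then show "dist (m s) (m t) \<le> 1 * dist s t"
          using m_le[of s t] m_le[of t s] by (cases "s \<le> t") (auto simp: dist_real_def)
      qed simp
      then show "continuous_on {a..b} g" unfolding g_def
        using lipschitz_on_continuous_on[OF lip] lipschitz_on_continuous_on[of 1 "{a..b}" m]
        by (intro continuous_intros) auto
      fix t assume t: "a \<le> t" "t < b"
      show "\<exists>d>0. \<forall>s. t < s \<and> s < t + d \<and> s \<le> b \<longrightarrow> g t \<le> g s"
      proof (cases "t \<in> N")
        case True
        then have "t \<in> U" using U(2) by blast
        then obtain d where d: "d > 0" "ball t d \<subseteq> U" using U(1) open_contains_ball by metis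
        have "g t \<le> g s" if s: "t < s" "s < t + d" "s \<le> b" for s
        proof -
          have "{t<..s} \<subseteq> ball t d" using s by (auto simp: dist_real_def)
          then have "m s - m t = s - t" using t s d(2) by (intro m_eq) auto
          then have "C * m s - C * m t = C * (s - t)" by (metis right_diff_distrib)
          moreover have "f t - f s \<le> C * (s - t)" using lipD[of t s] t s by auto
          moreover have "e * t \<le> e * s" using e s by simp
          ultimately show ?thesis unfolding g_def by linarith
        qed
        then show ?thesis using d(1) by blast
      next
        case False
        then obtain d where d: "d > 0" "\<forall>s. t < s \<and> s < t + d \<and> s \<le> b \<longrightarrow> f t - e * (s - t) \<le> f s"
          using step[OF t _ e] by blast
        have "g t \<le> g s" if s: "t < s" "s < t + d" "s \<le> b" for s
        proof -
          have "f t - e * (s - t) \<le> f s" using d(2) s by blast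
          moreover have "C * m t \<le> C * m s" using C m_le(2)[of t s] t s by (intro mult_left_mono) auto
          ultimately show ?thesis unfolding g_def by (simp add: algebra_simps)
        qed
        then show ?thesis using d(1) by blast
      qed
    qed
    moreover have "m a \<ge> 0" "m b \<le> e"
      unfolding m_def using measure_mono_fmeasurable[of "U \<inter> {a..b}" U lebesgue] Ilm[of "{a..b}"] Ulm muU
      by (auto dest: fmeasurableD)
    then have "C * m b \<le> C * e" "0 \<le> C * m a" using C by (auto intro: mult_left_mono)
    ultimately show ?thesis unfolding g_def by (simp add: algebra_simps)
  qed
  have K: "C + (b - a) \<ge> 0" using C ab by simp
  show ?thesis
  proof (rule field_le_epsilon)
    fix e :: real assume e: "e > 0"
    let ?k = "C + (b - a) + 1"
    have "f a \<le> f b + (e / ?k) * (C + (b - a))" using e K by (intro approx) auto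
    also have "(e / ?k) * (C + (b - a)) \<le> (e / ?k) * ?k"
      using e K by (intro mult_left_mono) auto
    also have "\<dots> = e" using K by simp
    finally show "f a \<le> f b + e" by simp
  qed
qed

section \<open>Lengths of ordered sets\<close>
fun polygon_length :: "'a::real_normed_vector list \<Rightarrow> real" where
  "polygon_length (x # y # xs) = norm (y - x) + polygon_length (y # xs)"
| "polygon_length _ = 0"

lemma polygon_length_eq_sum:
  "polygon_length xs = (\<Sum>k<length xs - 1. norm (xs ! Suc k - xs ! k))"
proof (induction xs rule: polygon_length.induct)
  case (1 x y xs)
  then show ?case by (simp add: sum.lessThan_Suc_shift del: sum.lessThan_Suc)
qed auto

lemma polygon_length_nonneg [simp]: "polygon_length xs \<ge> 0"
  by (induction xs rule: polygon_length.induct) auto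

lemma polygon_length_split: "polygon_length (xs @ p # ys) = polygon_length (xs @ [p]) + polygon_length (p # ys)"
  by (induction xs rule: polygon_length.induct) (auto simp: neq_Nil_conv)

lemma polygon_length_snoc:
  "xs \<noteq> [] \<Longrightarrow> polygon_length (xs @ [p]) = polygon_length xs + norm (p - last xs)"
  by (induction xs rule: polygon_length.induct) auto

lemma polygon_length_insert: "polygon_length (xs @ ys) \<le> polygon_length (xs @ p # ys)"
proof (cases "xs = [] \<or> ys = []")
  case True
  then show ?thesis
    by (cases xs; cases ys) (auto simp: polygon_length_snoc[of "_ # _", simplified] )
next
  case False
  then obtain x xs' y ys' where *: "xs = xs' @ [x]" "ys = y # ys'"
    by (metis list.exhaust rev_exhaust)
  have "norm (y - x) \<le> norm (y - p) + norm (p - x)"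
    using norm_triangle_ineq[of "y - p" "p - x"] by simp
  then show ?thesis
    using polygon_length_split[of xs' x "y # ys'"] polygon_length_split[of xs' x "p # y # ys'"] * by simp
qed

lemma polygon_length_rev: "polygon_length (rev xs) = polygon_length xs"
proof (induction xs rule: polygon_length.induct)
  case (1 x y xs)
  then show ?case
    using polygon_length_snoc[of "rev (y # xs)" x] by (simp add: norm_minus_commute)
qed auto

definition chains :: "'a rel \<Rightarrow> 'a set \<Rightarrow> 'a list set" where
  "chains r A = {xs. set xs \<subseteq> A \<and> sorted_wrt (\<lambda>x y. (x, y) \<in> r) xs}"

lemma chains_mono:
  assumes "A \<subseteq> B" "\<And>x y. \<lbrakk>x \<in> A; y \<in> A; (x, y) \<in> r\<rbrakk> \<Longrightarrow> (x, y) \<in> s"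
  shows "chains r A \<subseteq> chains s B"
  unfolding chains_def
proof clarify
  fix xs assume xs: "set xs \<subseteq> A" "sorted_wrt (\<lambda>x y. (x, y) \<in> r) xs"
  have "sorted_wrt (\<lambda>x y. (x, y) \<in> s) xs"
    by (rule sorted_wrt_mono_rel[OF _ xs(2)]) (use xs(1) assms(2) in blast)
  then show "set xs \<subseteq> B \<and> sorted_wrt (\<lambda>x y. (x, y) \<in> s) xs" using xs(1) assms(1) by simp
qed

lemma chains_append:
  "xs @ ys \<in> chains r A \<longleftrightarrow> xs \<in> chains r A \<and> ys \<in> chains r A \<and> (\<forall>x\<in>set xs. \<forall>y\<in>set ys. (x, y) \<in> r)"
  by (auto simp: chains_def sorted_wrt_append)

lemma chains_simps [simp]:
  "[] \<in> chains r A"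
  "x # xs \<in> chains r A \<longleftrightarrow> x \<in> A \<and> xs \<in> chains r A \<and> (\<forall>y\<in>set xs. (x, y) \<in> r)"
  by (auto simp: chains_def)

lemma curve_length_eq: "curve_length r A = (SUP xs\<in>chains r A. ennreal (polygon_length xs))"
  by (simp add: curve_length_def chains_def polygon_length_eq_sum)

lemma chain_le_curve_length: "xs \<in> chains r A \<Longrightarrow> ennreal (polygon_length xs) \<le> curve_length r A"
  unfolding curve_length_eq by (rule SUP_upper)

lemma curve_length_mono:
  assumes "A \<subseteq> B" "\<And>x y. \<lbrakk>x \<in> A; y \<in> A; (x, y) \<in> r\<rbrakk> \<Longrightarrow> (x, y) \<in> s"
  shows "curve_length r A \<le> curve_length s B"
  unfolding curve_length_eq by (rule SUP_subset_mono[OF chains_mono[OF assms]]) auto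

lemma chains_converse: "xs \<in> chains (r\<inverse>) A \<longleftrightarrow> rev xs \<in> chains r A"
  by (simp add: chains_def sorted_wrt_rev)

text \<open>Two polygons on either side of \<open>p\<close> form one polygon; this is half of the additivity of length.\<close>
lemma chains_concat_le_curve_length:
  assumes tr: "trans r" and xs: "xs \<in> chains r {x \<in> A. (x, p) \<in> r}" and ys: "ys \<in> chains r {x \<in> A. (p, x) \<in> r}"
  shows "ennreal (polygon_length xs) + ennreal (polygon_length ys) \<le> curve_length r A"
proof -
  have "\<forall>x\<in>set xs. \<forall>y\<in>set ys. (x, y) \<in> r"
    using xs ys transD[OF tr] unfolding chains_def by blast
  moreover have "xs \<in> chains r A" "ys \<in> chains r A"
    using xs ys by (auto simp: chains_def)
  ultimately have c: "xs @ ys \<in> chains r A" by (simp add: chains_append)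
  have "polygon_length xs + polygon_length ys \<le> polygon_length (xs @ ys)"
  proof (cases ys)
    case (Cons y zs)
    then show ?thesis
      using polygon_length_split[of xs y zs] polygon_length_insert[of xs "[]" y] by simp
  qed simp
  then show ?thesis
    using chain_le_curve_length[OF c] by (simp flip: ennreal_plus) (meson ennreal_leI order_trans)
qed

text \<open>A polygon through \<open>A\<close> does not become shorter when \<open>p\<close> is inserted as a vertex, and there it can be cut
  in two.\<close>
lemma curve_length_split:
  assumes tr: "trans r" and p: "p \<in> A" and tot: "\<And>x. x \<in> A \<Longrightarrow> (x, p) \<in> r \<or> (p, x) \<in> r"
  shows "curve_length r A = curve_length r {x \<in> A. (x, p) \<in> r} + curve_length r {x \<in> A. (p, x) \<in> r}"
    (is "_ = curve_length r ?L + curve_length r ?R")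
proof (rule antisym)
  have pp: "(p, p) \<in> r" using tot[OF p] by simp
  show "curve_length r A \<le> curve_length r ?L + curve_length r ?R"
    unfolding curve_length_eq[of r A]
  proof (rule SUP_least)
    fix xs assume xs: "xs \<in> chains r A"
    define ys zs where "ys = takeWhile (\<lambda>x. (x, p) \<in> r) xs" and "zs = dropWhile (\<lambda>x. (x, p) \<in> r) xs"
    have xs_eq: "xs = ys @ zs" by (simp add: ys_def zs_def)
    have ys: "ys @ [p] \<in> chains r ?L"
      using xs pp p unfolding xs_eq chains_append by (auto simp: ys_def chains_def dest: set_takeWhileD)
    have zsc: "zs \<in> chains r A" using xs unfolding xs_eq chains_append by blast
    have "(p, z) \<in> r" if "z \<in> set zs" for z
    proof -
      obtain y ws where zy: "zs = y # ws" using \<open>z \<in> set zs\<close> by (cases zs) auto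
      then have "(y, p) \<notin> r" unfolding zs_def by (metis hd_dropWhile list.distinct(1) list.sel(1))
      moreover have "y \<in> A" using zsc zy by simp
      ultimately have "(p, y) \<in> r" using tot by blast
      moreover have "z = y \<or> (y, z) \<in> r" using that zsc zy by auto
      ultimately show ?thesis using transD[OF tr] by blast
    qed
    then have zs: "p # zs \<in> chains r ?R"
      using zsc p pp by (auto simp: chains_def)
    have "polygon_length xs \<le> polygon_length (ys @ [p]) + polygon_length (p # zs)"
      unfolding xs_eq by (metis polygon_length_insert polygon_length_split)
    then have "ennreal (polygon_length xs) \<le> ennreal (polygon_length (ys @ [p])) + ennreal (polygon_length (p # zs))"
      by (simp flip: ennreal_plus add: ennreal_leI)
    also have "\<dots> \<le> curve_length r ?L + curve_length r ?R"
      by (intro add_mono chain_le_curve_length ys zs)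
    finally show "ennreal (polygon_length xs) \<le> curve_length r ?L + curve_length r ?R" .
  qed
  have ne: "chains r B \<noteq> {}" for B using chains_simps(1) by blast
  show "curve_length r ?L + curve_length r ?R \<le> curve_length r A"
  proof -
    have "ennreal (polygon_length xs) + curve_length r ?R \<le> curve_length r A" if "xs \<in> chains r ?L" for xs
      unfolding curve_length_eq[of r ?R] ennreal_SUP_add_right[OF ne]
      by (intro SUP_least chains_concat_le_curve_length[OF tr that])
    then show ?thesis
      unfolding curve_length_eq[of r ?L] ennreal_SUP_add_left[OF ne, symmetric] by (intro SUP_least)
  qed
qed

lemma curve_length_cong:
  assumes "\<And>x y. \<lbrakk>x \<in> A; y \<in> A\<rbrakk> \<Longrightarrow> (x, y) \<in> r \<longleftrightarrow> (x, y) \<in> s"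
  shows "curve_length r A = curve_length s A"
  using assms by (intro antisym curve_length_mono) auto

section \<open>Planar self-distancing sets have finite length\<close>

lemma plane_orthonormal_expansion:
  fixes v a b :: plane
  assumes "norm v = 1"
  defines "w \<equiv> vector [- (v $ 2), v $ 1]"
  shows "a \<bullet> b = (v \<bullet> a) * (v \<bullet> b) + (w \<bullet> a) * (w \<bullet> b)"
proof -
  have "(v $ 1)\<^sup>2 + (v $ 2)\<^sup>2 = 1"
    using assms(1) by (simp add: norm_eq_1 inner_vec_def sum_2 power2_eq_square)
  then show ?thesis
    unfolding w_def inner_vec_def sum_2 by (simp add: sum_2) algebra
qed

text \<open>Here \<open>Y\<close> are the vertices so far, \<open>c\<close> the last of them and \<open>d\<close> the next one. In coordinates at \<open>d\<close>
  with first axis along \<open>d - c\<close>, each \<open>y\<close> is \<open>- t\<close> along this axis with \<open>t \<ge> norm (d - c) / 2\<close>, and \<open>s\<close>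
  across it. As any two of these points are seen from \<open>d\<close> under an acute angle, they cannot
  be more than 45 degrees off the axis on both sides: either \<open>s \<le> t\<close> for all or \<open>- s \<le> t\<close> for all.
  Hence a direction slightly tilted towards the side with this bound separates \<open>d\<close> from \<open>Y\<close> by a fixed part of
  the step, with enough slack to take that direction from a finite net.\<close>
lemma ex_gaining_direction:
  fixes Y :: "plane set" and c d :: plane
  assumes net: "\<And>a::plane. norm a \<le> 5 \<Longrightarrow> \<exists>u\<in>U. norm (u - a) \<le> 1"
    and far: "\<And>y. y \<in> Y \<Longrightarrow> norm (c - y) \<le> norm (d - y)"
    and angle: "\<And>y z. \<lbrakk>y \<in> Y; z \<in> Y\<rbrakk> \<Longrightarrow> (y - d) \<bullet> (z - d) \<ge> 0"
    and "c \<noteq> d"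
  shows "\<exists>u\<in>U. \<forall>y\<in>Y. u \<bullet> y \<le> u \<bullet> d - norm (d - c) / 2"
proof -
  define e where "e = norm (d - c)"
  define v where "v = (d - c) /\<^sub>R e"
  define w :: plane where "w = vector [- (v $ 2), v $ 1]"
  have e: "e > 0" using \<open>c \<noteq> d\<close> by (simp add: e_def)
  have v: "norm v = 1" using e by (simp add: v_def e_def)
  have ev: "d - c = e *\<^sub>R v" using e by (simp add: v_def)
  have expand: "a \<bullet> b = (v \<bullet> a) * (v \<bullet> b) + (w \<bullet> a) * (w \<bullet> b)" for a b
    unfolding w_def by (rule plane_orthonormal_expansion[OF v])
  have vv: "v \<bullet> v = 1" using v by (simp add: norm_eq_1)
  have vw: "v \<bullet> w = 0" and ww: "w \<bullet> w = 1"
  proof -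
    show "v \<bullet> w = 0" by (simp add: w_def inner_vec_def sum_2)
    show "w \<bullet> w = 1" using vv by (simp add: w_def inner_vec_def sum_2)
  qed
  define t s where "t y = - (v \<bullet> (y - d))" and "s y = w \<bullet> (y - d)" for y
  have t: "t y \<ge> e / 2" if "y \<in> Y" for y
  proof -
    have "(norm (c - y))\<^sup>2 \<le> (norm (d - y))\<^sup>2" using far[OF that] by (simp add: power_mono)
    moreover have "c - y = (d - y) - e *\<^sub>R v" using ev by (simp add: algebra_simps)
    then have "(norm (c - y))\<^sup>2 = (d - y) \<bullet> (d - y) - 2 * (e * (v \<bullet> (d - y))) + e * (e * (v \<bullet> v))"
      by (simp only: power2_norm_eq_inner inner_diff_left[of "d - y"] inner_diff_right[of _ "d - y"])
         (simp add: inner_commute)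
    then have "(norm (c - y))\<^sup>2 = (norm (d - y))\<^sup>2 - 2 * e * (v \<bullet> (d - y)) + e * e"
      using vv by (simp add: power2_norm_eq_inner)
    ultimately have "e * e \<le> e * (2 * (v \<bullet> (d - y)))" by simp
    then have "e \<le> 2 * (v \<bullet> (d - y))" using e by (simp only: mult_le_cancel_left_pos)
    then show ?thesis by (simp add: t_def inner_diff_right)
  qed
  have acute: "t y * t z + s y * s z \<ge> 0" if "y \<in> Y" "z \<in> Y" for y z
    using angle[OF that] expand[of "y - d" "z - d"] by (simp add: t_def s_def)
  have key: "\<exists>u\<in>U. \<forall>y\<in>Y. u \<bullet> y \<le> u \<bullet> d - e / 2"
    if k: "k = 1 \<or> k = -1" and side: "\<And>y. y \<in> Y \<Longrightarrow> k * s y \<le> t y" for k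
  proof -
    \<comment> \<open>The length \<open>sqrt 17\<close> of \<open>a\<close> is below the radius 5 of the net; the product of \<open>a\<close> with \<open>y - d\<close> is at
      most \<open>- 4 * t + k * s\<close>, and passing to the net costs at most \<open>norm (y - d) \<le> t + \<bar>s\<bar>\<close>.\<close>
    define a where "a = 4 *\<^sub>R v + k *\<^sub>R w"
    have kk: "k * k = 1" using k by auto
    have "(norm a)\<^sup>2 = 17" unfolding a_def power2_norm_eq_inner
      using vv vw ww kk by (simp add: inner_add_left inner_add_right inner_commute)
    then have "norm a \<le> 5" using power2_le_imp_le[of "norm a" 5] by simp
    then obtain u where u: "u \<in> U" "norm (u - a) \<le> 1" using net by blast
    have "u \<bullet> y \<le> u \<bullet> d - e / 2" if y: "y \<in> Y" for y
    proof -
      have tp: "t y \<ge> 0" using t[OF y] e by simp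
      have "(norm (y - d))\<^sup>2 = (t y)\<^sup>2 + (s y)\<^sup>2"
        unfolding power2_norm_eq_inner using expand[of "y - d" "y - d"] by (simp add: t_def s_def power2_eq_square)
      also have "\<dots> \<le> (t y + \<bar>s y\<bar>)\<^sup>2" using tp by (simp add: power2_sum)
      finally have "norm (y - d) \<le> t y + \<bar>s y\<bar>" using tp by (simp add: power2_le_iff_abs_le)
      moreover have "(u - a) \<bullet> (y - d) \<le> norm (y - d)"
        using norm_cauchy_schwarz[of "u - a" "y - d"] mult_right_mono[OF u(2), of "norm (y - d)"] by simp
      moreover have "a \<bullet> (y - d) = - 4 * t y + k * s y"
        by (simp add: a_def t_def s_def inner_add_left)
      ultimately have "u \<bullet> (y - d) \<le> - 3 * t y + (k * s y + \<bar>s y\<bar>)"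
        by (simp add: inner_diff_left)
      also have "\<dots> \<le> - t y" using side[OF y] tp k by (auto simp: abs_if)
      finally show ?thesis using t[OF y] by (simp add: inner_diff_right)
    qed
    then show ?thesis using u(1) by blast
  qed
  show ?thesis
  proof (cases "\<forall>y\<in>Y. s y \<le> t y")
    case True
    then show ?thesis using key[of 1] unfolding e_def by simp
  next
    case False
    then obtain y where y: "y \<in> Y" "s y > t y" by auto
    have "- s z \<le> t z" if "z \<in> Y" for z
    proof (rule ccontr)
      assume "\<not> - s z \<le> t z"
      then have z: "t z < - s z" by simp
      have "0 < t y" "0 < t z" using t[OF y(1)] t[OF that] e by auto
      then have "t y * t z < s y * (- s z)" using y(2) z by (intro mult_strict_mono) auto
      then show False using acute[OF y(1) that] by simp
    qed
    then show ?thesis using key[of "-1"] unfolding e_def by simp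
  qed
qed

definition directional_extent :: "plane set \<Rightarrow> plane set \<Rightarrow> real" where
  "directional_extent U Y = (\<Sum>u\<in>U. Max ((\<bullet>) u ` Y))"

lemma directional_extent_insert:
  assumes "finite U" "finite Y" "Y \<noteq> {}" "u \<in> U" "\<And>y. y \<in> Y \<Longrightarrow> u \<bullet> y \<le> u \<bullet> d - g"
  shows "directional_extent U Y + g \<le> directional_extent U (insert d Y)"
proof -
  have 1: "Max ((\<bullet>) x ` Y) \<le> Max ((\<bullet>) x ` insert d Y)" for x
    using assms(2,3) by (intro Max_mono) auto
  have 2: "Max ((\<bullet>) u ` Y) + g \<le> Max ((\<bullet>) u ` insert d Y)"
  proof -
    have "Max ((\<bullet>) u ` Y) \<le> u \<bullet> d - g" using assms by (intro Max.boundedI) auto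
    moreover have "u \<bullet> d \<le> Max ((\<bullet>) u ` insert d Y)" using assms(2) by (intro Max_ge) auto
    ultimately show ?thesis by simp
  qed
  have "(\<Sum>x\<in>U - {u}. Max ((\<bullet>) x ` Y)) \<le> (\<Sum>x\<in>U - {u}. Max ((\<bullet>) x ` insert d Y))"
    by (intro sum_mono 1)
  then show ?thesis
    unfolding directional_extent_def using 2 by (simp only: sum.remove[OF assms(1,4)])
qed

lemma directional_extent_mono:
  assumes "finite Y" "Y \<noteq> {}"
  shows "directional_extent U Y \<le> directional_extent U (insert d Y)"
  unfolding directional_extent_def using assms by (intro sum_mono Max_mono) auto

text \<open>A side of a triangle that is no longer than another side is not opposite an obtuse angle.\<close>
lemma acute_if_distances_ordered:
  fixes y z d :: "'a::real_inner"
  assumes "norm (z - y) \<le> norm (d - y) \<or> norm (y - z) \<le> norm (d - z)"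
  shows "(y - d) \<bullet> (z - d) \<ge> 0"
proof -
  have sq: "norm a \<le> norm b \<Longrightarrow> a \<bullet> a \<le> b \<bullet> b" for a b :: 'a
    by (simp add: norm_le)
  have eq: "(z - y) \<bullet> (z - y) = (y - d) \<bullet> (y - d) + (z - d) \<bullet> (z - d) - 2 * ((y - d) \<bullet> (z - d))"
    "(y - z) \<bullet> (y - z) = (z - y) \<bullet> (z - y)" "(d - y) \<bullet> (d - y) = (y - d) \<bullet> (y - d)"
    "(d - z) \<bullet> (d - z) = (z - d) \<bullet> (z - d)"
    by (simp_all add: inner_diff_left inner_diff_right inner_commute)
  have pos: "(y - d) \<bullet> (y - d) \<ge> 0" "(z - d) \<bullet> (z - d) \<ge> 0" by simp_all
  from assms show ?thesis
  proof
    assume "norm (z - y) \<le> norm (d - y)"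
    then show ?thesis using sq[of "z - y" "d - y"] eq pos by linarith
  next
    assume "norm (y - z) \<le> norm (d - z)"
    then show ?thesis using sq[of "y - z" "d - z"] eq pos by linarith
  qed
qed

lemma finite_unit_net: "\<exists>U::plane set. finite U \<and> U \<subseteq> cball 0 5 \<and> (\<forall>a. norm a \<le> 5 \<longrightarrow> (\<exists>u\<in>U. norm (u - a) \<le> 1))"
proof -
  have "compact (cball 0 5 :: plane set)" by simp
  then obtain U :: "plane set" where U: "finite U" "U \<subseteq> cball 0 5" "cball 0 5 \<subseteq> (\<Union>x\<in>U. ball x 1)"
    by (rule compactE_image[of _ "cball 0 5" "\<lambda>x. ball x 1"]) auto
  have "\<exists>u\<in>U. norm (u - a) \<le> 1" if "norm a \<le> 5" for a
  proof -
    have "a \<in> (\<Union>x\<in>U. ball x 1)" by (rule subsetD[OF U(3)]) (simp add: that)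
    then show ?thesis by (auto simp: dist_norm intro: less_imp_le)
  qed
  then show ?thesis using U by blast
qed

text \<open>Along a chain the sum of the extents in the directions of the net grows by half of every step, and
  it stays bounded since \<open>\<sigma>\<close> is bounded.\<close>
lemma polygon_lengths_bounded:
  fixes \<sigma> :: "plane set"
  assumes bdd: "bounded \<sigma>"
    and sd: "\<And>x y z. \<lbrakk>(x, y) \<in> r; (y, z) \<in> r\<rbrakk> \<Longrightarrow> norm (y - x) \<le> norm (z - x)"
  shows "\<exists>M. \<forall>xs\<in>chains r \<sigma>. polygon_length xs \<le> M"
proof -
  obtain D where D: "D > 0" "\<And>x. x \<in> \<sigma> \<Longrightarrow> norm x \<le> D" using bdd by (auto simp: bounded_pos)
  obtain U :: "plane set" where U: "finite U" "U \<subseteq> cball 0 5"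
    "\<And>a. norm a \<le> 5 \<Longrightarrow> \<exists>u\<in>U. norm (u - a) \<le> 1" using finite_unit_net by blast
  have ux: "\<bar>u \<bullet> x\<bar> \<le> 5 * D" if "u \<in> U" "x \<in> \<sigma>" for u x
  proof -
    have "norm u * norm x \<le> 5 * D" using that U(2) D by (intro mult_mono) auto
    then show ?thesis using Cauchy_Schwarz_ineq2[of u x] by simp
  qed
  define K where "K = real (card U) * (5 * D)"
  have extent: "\<bar>directional_extent U Y\<bar> \<le> K" if Y: "finite Y" "Y \<noteq> {}" "Y \<subseteq> \<sigma>" for Y
  proof -
    have "\<bar>Max ((\<bullet>) u ` Y)\<bar> \<le> 5 * D" if "u \<in> U" for u
    proof -
      have "Max ((\<bullet>) u ` Y) \<in> (\<bullet>) u ` Y" using Y by (intro Max_in) auto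
      then show ?thesis using ux[OF that] Y(3) by auto
    qed
    then have "(\<Sum>u\<in>U. \<bar>Max ((\<bullet>) u ` Y)\<bar>) \<le> K" unfolding K_def by (intro sum_bounded_above) auto
    then show ?thesis unfolding directional_extent_def by (rule order_trans[OF sum_abs])
  qed
  have "polygon_length xs \<le> 2 * (directional_extent U (set xs) + K)" if "xs \<in> chains r \<sigma>" "xs \<noteq> []" for xs
    using that
  proof (induction xs rule: rev_induct)
    case (snoc d ys)
    show ?case
    proof (cases "ys = []")
      case True
      then show ?thesis using extent[of "{d}"] snoc.prems by auto
    next
      case False
      define c where "c = last ys"
      have c: "c \<in> set ys" "ys = butlast ys @ [c]" using False by (auto simp: c_def)
      have ysc: "ys \<in> chains r \<sigma>" and yd: "\<And>y. y \<in> set ys \<Longrightarrow> (y, d) \<in> r"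
        using snoc.prems(1) unfolding chains_append by auto
      have yc: "(y, c) \<in> r \<or> y = c" if "y \<in> set ys" for y
        using ysc that c(2) by (metis Un_iff chains_append empty_iff list.set(1) set_ConsD set_append list.set_intros(1))
      have yz: "(y, z) \<in> r \<or> (z, y) \<in> r \<or> y = z" if "y \<in> set ys" "z \<in> set ys" for y z
        using ysc that unfolding chains_def by (auto simp: sorted_wrt_iff_nth_less in_set_conv_nth) (metis nat_neq_iff)
      have IH: "polygon_length ys \<le> 2 * (directional_extent U (set ys) + K)"
        using snoc.IH ysc False by blast
      have "directional_extent U (set ys) + norm (d - c) / 2 \<le> directional_extent U (insert d (set ys))"
      proof (cases "c = d")
        case True
        then show ?thesis using directional_extent_mono[of "set ys" U d] False by simp
      next
        case cd: False
        have "\<exists>u\<in>U. \<forall>y\<in>set ys. u \<bullet> y \<le> u \<bullet> d - norm (d - c) / 2"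
        proof (rule ex_gaining_direction[OF U(3)])
          show "norm (c - y) \<le> norm (d - y)" if "y \<in> set ys" for y
            using yc[OF that] sd[of y c d] yd[OF c(1)] by auto
          show "(y - d) \<bullet> (z - d) \<ge> 0" if "y \<in> set ys" "z \<in> set ys" for y z
            using yz[OF that] sd[of y z d] sd[of z y d] yd that
            by (intro acute_if_distances_ordered) auto
        qed (use cd in auto)
        then show ?thesis using directional_extent_insert[OF U(1), of "set ys"] False by blast
      qed
      moreover have "polygon_length (ys @ [d]) = polygon_length ys + norm (d - c)"
        using polygon_length_snoc[OF False] by (simp add: c_def)
      ultimately show ?thesis using IH by simp
    qed
  qed simp
  moreover have "directional_extent U (set xs) \<le> K" if "xs \<in> chains r \<sigma>" "xs \<noteq> []" for xs
    using extent[of "set xs"] that by (auto simp: chains_def)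
  ultimately have "polygon_length xs \<le> max 0 (4 * K)" if "xs \<in> chains r \<sigma>" for xs
    using that by (cases "xs = []") fastforce+
  then show ?thesis by blast
qed

section \<open>Compact pieces and their arc length\<close>
lemma polygon_length_const: "set xs \<subseteq> {p} \<Longrightarrow> polygon_length xs = 0"
  by (induction xs rule: polygon_length.induct) auto

text \<open>Since the order is antisymmetric, the occurrences of the greatest point \<open>p\<close> stand together at the
  end of a chain.\<close>
lemma polygon_length_drop_endpoint:
  assumes "sorted_wrt (\<lambda>x y. (x, y) \<in> r) xs" "\<And>x. x \<in> set xs \<Longrightarrow> (x, p) \<in> r" "antisym r"
  shows "polygon_length (xs @ [p]) = polygon_length (filter (\<lambda>x. x \<noteq> p) xs @ [p])"
  using assms(1,2)
proof (induction xs)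
  case (Cons x xs)
  have IH: "polygon_length (xs @ [p]) = polygon_length (filter (\<lambda>x. x \<noteq> p) xs @ [p])"
    using Cons by simp
  have allp: "set ys \<subseteq> {p}" if "p # ys = x # xs \<or> p # ys = xs" for ys
    using that Cons.prems antisymD[OF assms(3)] by auto
  show ?case
  proof (cases "x = p")
    case True
    then have "set xs \<subseteq> {p}" using allp by blast
    then show ?thesis using True polygon_length_const[of "p # xs @ [p]" p] polygon_length_const[of "[p]" p]
      by (auto simp: filter_empty_conv subset_iff cong: filter_cong)
  next
    case xp: False
    show ?thesis
    proof (cases xs)
      case (Cons y ys)
      show ?thesis
      proof (cases "y = p")
        case True
        then have "set ys \<subseteq> {p}" using allp Cons by blast
        then have "polygon_length (p # ys @ [p]) = 0" "filter (\<lambda>x. x \<noteq> p) ys = []"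
          by (auto intro!: polygon_length_const simp: filter_empty_conv)
        then show ?thesis using xp Cons True by simp
      qed (use xp Cons IH in simp)
    qed (use xp in simp)
  qed
qed simp

text \<open>Moving the last vertex \<open>p\<close> of a polygon to a nearby \<open>p'\<close> costs at most the distance, provided that the
  vertices before \<open>p\<close> still precede \<open>p'\<close>; this holds near \<open>p\<close> because initial segments are
  closed. The order is left abstract so that the lemma also applies to the reversed order.\<close>
lemma polygon_length_lower_semicontinuous:
  fixes A :: "'a::real_normed_vector set"
  assumes ord: "trans r" "antisym r" and tot: "\<And>x y. \<lbrakk>x \<in> A; y \<in> A\<rbrakk> \<Longrightarrow> (x, y) \<in> r \<or> (y, x) \<in> r"
    and cl: "\<And>q. q \<in> A \<Longrightarrow> closed {x \<in> A. (x, q) \<in> r}"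
    and p: "p \<in> A" and xs: "xs \<in> chains r {x \<in> A. (x, p) \<in> r}" and e: "e > 0"
  shows "\<exists>d>0. \<forall>p'\<in>A. norm (p' - p) < d \<longrightarrow>
    (\<exists>ys\<in>chains r {x \<in> A. (x, p') \<in> r}. polygon_length xs - e < polygon_length ys)"
proof -
  define ys where "ys = filter (\<lambda>x. x \<noteq> p) xs"
  have "polygon_length xs \<le> polygon_length (xs @ [p])"
    using polygon_length_insert[of xs "[]" p] by simp
  also have "\<dots> = polygon_length (ys @ [p])"
    unfolding ys_def by (rule polygon_length_drop_endpoint) (use xs ord in \<open>auto simp: chains_def\<close>)
  finally have le: "polygon_length xs \<le> polygon_length (ys @ [p])" .
  have ysA: "y \<in> A" "(y, p) \<in> r" "y \<noteq> p" if "y \<in> set ys" for y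
    using that xs by (auto simp: ys_def chains_def)
  have yss: "sorted_wrt (\<lambda>x y. (x, y) \<in> r) ys"
    using xs by (auto simp: ys_def chains_def sorted_wrt_filter)
  show ?thesis
  proof (cases "ys = []")
    case True
    then have "polygon_length xs - e < polygon_length ([] :: 'a list)" using le e by simp
    then show ?thesis by (intro exI[of _ 1]) (use chains_simps(1) in \<open>auto intro!: bexI[of _ "[]"]\<close>)
  next
    case False
    define q where "q = last ys"
    have q: "q \<in> set ys" using False by (simp add: q_def)
    have yq: "y = q \<or> (y, q) \<in> r" if "y \<in> set ys" for y
    proof -
      have "ys = butlast ys @ [q]" using False by (simp add: q_def)
      then show ?thesis using yss that sorted_wrt_append[of _ "butlast ys" "[q]"]
        by (metis Un_iff list.set_intros(1) set_ConsD set_append list.set(1) empty_iff)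
    qed
    have "(p, q) \<notin> r" using ysA[OF q] antisymD[OF ord(2)] by blast
    then have "p \<in> - {x \<in> A. (x, q) \<in> r}" by simp
    moreover have "open (- {x \<in> A. (x, q) \<in> r})" using cl[OF ysA(1)[OF q]] by (simp add: open_Compl)
    ultimately obtain d where d: "d > 0" "ball p d \<subseteq> - {x \<in> A. (x, q) \<in> r}"
      using open_contains_ball by meson
    have "\<exists>zs\<in>chains r {x \<in> A. (x, p') \<in> r}. polygon_length xs - e < polygon_length zs"
      if p': "p' \<in> A" "norm (p' - p) < min d e" for p'
    proof (intro bexI)
      have "p' \<in> ball p d" using p'(2) by (simp add: dist_norm norm_minus_commute)
      then have "(p', q) \<notin> r" using d(2) p'(1) by blast
      then have qp': "(q, p') \<in> r" using tot[OF p'(1) ysA(1)[OF q]] by blast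
      have yp': "(y, p') \<in> r" if "y \<in> set ys" for y using yq[OF that] qp' transD[OF ord(1)] by blast
      have "(p', p') \<in> r" using tot[OF p'(1) p'(1)] by simp
      then show "ys @ [p'] \<in> chains r {x \<in> A. (x, p') \<in> r}"
        using yss yp' ysA(1) p'(1) by (auto simp: chains_def sorted_wrt_append)
      have "norm (p - q) \<le> norm (p' - q) + norm (p' - p)"
        using norm_triangle_ineq4[of "p' - q" "p' - p"] by simp
      then show "polygon_length xs - e < polygon_length (ys @ [p'])"
        using le p'(2) polygon_length_snoc[OF False] unfolding q_def by simp
    qed
    then show ?thesis using d(1) e by (intro exI[of _ "min d e"]) auto
  qed
qed

locale self_distancing_set =
  fixes \<sigma> :: "plane set" and r :: "plane rel"
  assumes sd: "self_distancing \<sigma> r"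
begin

lemma lin: "linear_order_on \<sigma> r" and bdd: "bounded \<sigma>"
  and dist_mono: "\<lbrakk>(x, y) \<in> r; (y, z) \<in> r\<rbrakk> \<Longrightarrow> norm (y - x) \<le> norm (z - x)"
  using sd unfolding self_distancing_def by blast+

lemma r_trans: "trans r" and r_antisym: "antisym r"
  and r_total: "\<lbrakk>x \<in> \<sigma>; y \<in> \<sigma>\<rbrakk> \<Longrightarrow> (x, y) \<in> r \<or> (y, x) \<in> r"
  and r_refl: "x \<in> \<sigma> \<Longrightarrow> (x, x) \<in> r"
  and r_carrier: "(x, y) \<in> r \<Longrightarrow> x \<in> \<sigma> \<and> y \<in> \<sigma>"
proof -
  show "trans r" "antisym r" and refl: "x \<in> \<sigma> \<Longrightarrow> (x, x) \<in> r" for x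
    using lin unfolding order_on_defs refl_on_def by auto
  show "\<lbrakk>x \<in> \<sigma>; y \<in> \<sigma>\<rbrakk> \<Longrightarrow> (x, y) \<in> r \<or> (y, x) \<in> r"
    using lin refl unfolding order_on_defs total_on_def by metis
  show "(x, y) \<in> r \<Longrightarrow> x \<in> \<sigma> \<and> y \<in> \<sigma>"
    using lin unfolding order_on_defs by auto
qed

text \<open>If \<open>q\<close> strictly preceded the limit \<open>p\<close> of points \<open>X n \<preceq> q\<close>, then \<open>q\<close> would be at most as far from
  \<open>X n\<close> as \<open>p\<close> is, and hence a limit of the \<open>X n\<close> too.\<close>
lemma closed_below:
  assumes A: "closed A" "A \<subseteq> \<sigma>" and q: "q \<in> \<sigma>"
  shows "closed {x \<in> A. (x, q) \<in> r}"
  unfolding closed_sequential_limits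
proof clarify
  fix X p assume X: "\<forall>n. X n \<in> {x \<in> A. (x, q) \<in> r}" and lim: "X \<longlonglongrightarrow> p"
  have p: "p \<in> A" using A(1) X lim unfolding closed_sequential_limits by blast
  show "p \<in> A \<and> (p, q) \<in> r"
  proof (cases "(p, q) \<in> r")
    case False
    then have "(q, p) \<in> r" using r_total p A(2) q by blast
    then have "norm (q - X n) \<le> norm (p - X n)" for n using X dist_mono by blast
    moreover have "(\<lambda>n. norm (p - X n)) \<longlonglongrightarrow> 0"
      using tendsto_norm[OF tendsto_diff[OF tendsto_const[of p] lim]] by simp
    ultimately have "(\<lambda>n. norm (q - X n)) \<longlonglongrightarrow> 0"
      by (intro Lim_null_comparison[of "\<lambda>n. norm (q - X n)"]) auto
    moreover have "(\<lambda>n. norm (q - X n)) \<longlonglongrightarrow> norm (q - p)"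
      by (intro tendsto_intros lim)
    ultimately have "norm (q - p) = 0" using LIMSEQ_unique by blast
    then show ?thesis using p r_refl q by simp
  qed (use p in simp)
qed

lemma closed_above:
  assumes A: "closed A" "A \<subseteq> \<sigma>" and q: "q \<in> \<sigma>"
  shows "closed {x \<in> A. (q, x) \<in> r}"
  unfolding closed_sequential_limits
proof clarify
  fix X p assume X: "\<forall>n. X n \<in> {x \<in> A. (q, x) \<in> r}" and lim: "X \<longlonglongrightarrow> p"
  have p: "p \<in> A" using A(1) X lim unfolding closed_sequential_limits by blast
  show "p \<in> A \<and> (q, p) \<in> r"
  proof (cases "(q, p) \<in> r")
    case False
    then have "(p, q) \<in> r" using r_total p A(2) q by blast
    then have "norm (q - p) \<le> norm (X n - p)" for n using X dist_mono by blast
    moreover have "(\<lambda>n. norm (X n - p)) \<longlonglongrightarrow> 0"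
      using tendsto_norm[OF tendsto_diff[OF lim tendsto_const[of p]]] by simp
    ultimately have "norm (q - p) \<le> 0" by (intro LIMSEQ_le_const) auto
    then show ?thesis using p r_refl q by simp
  qed (use p in simp)
qed

lemma finite_extremes:
  assumes "finite F" "F \<noteq> {}" "F \<subseteq> \<sigma>"
  shows "\<exists>m\<in>F. \<forall>y\<in>F. (m, y) \<in> r" "\<exists>m\<in>F. \<forall>y\<in>F. (y, m) \<in> r"
  using assms
proof (induction F rule: finite_ne_induct)
  case (singleton x)
  { case 1 then show ?case using r_refl by simp }
  { case 2 then show ?case using r_refl by simp }
next
  case (insert x F)
  { case 1
    then obtain m where m: "m \<in> F" "\<forall>y\<in>F. (m, y) \<in> r" using insert.IH(1) by auto
    then have "(x, m) \<in> r \<or> (m, x) \<in> r" using r_total 1 by auto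
    then show ?case using m r_refl[of x] 1 transD[OF r_trans] by (metis insert_iff insert_subset) }
  { case 2
    then obtain m where m: "m \<in> F" "\<forall>y\<in>F. (y, m) \<in> r" using insert.IH(2) by auto
    then have "(x, m) \<in> r \<or> (m, x) \<in> r" using r_total 2 by auto
    then show ?case using m r_refl[of x] 2 transD[OF r_trans] by (metis insert_iff insert_subset) }
qed

text \<open>A finite set has a least point, so the closed initial segments in a compact set have the
  finite intersection property.\<close>
lemma compact_extremes:
  assumes A: "compact A" "A \<noteq> {}" "A \<subseteq> \<sigma>"
  shows "\<exists>m\<in>A. \<forall>y\<in>A. (m, y) \<in> r" "\<exists>m\<in>A. \<forall>y\<in>A. (y, m) \<in> r"
proof -
  have cl: "closed A" using A(1) compact_imp_closed by blast
  have "A \<inter> (\<Inter>q\<in>A. {x \<in> A. (x, q) \<in> r}) \<noteq> {}"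
  proof (rule compact_imp_fip_image[OF A(1)])
    show "closed {x \<in> A. (x, q) \<in> r}" if "q \<in> A" for q using closed_below cl A(3) that by blast
    show "A \<inter> (\<Inter>q\<in>I. {x \<in> A. (x, q) \<in> r}) \<noteq> {}" if I: "finite I" "I \<subseteq> A" for I
      using finite_extremes(1)[of I] I A by (cases "I = {}") blast+
  qed
  then show "\<exists>m\<in>A. \<forall>y\<in>A. (m, y) \<in> r" by blast
  have "A \<inter> (\<Inter>q\<in>A. {x \<in> A. (q, x) \<in> r}) \<noteq> {}"
  proof (rule compact_imp_fip_image[OF A(1)])
    show "closed {x \<in> A. (q, x) \<in> r}" if "q \<in> A" for q using closed_above cl A(3) that by blast
    show "A \<inter> (\<Inter>q\<in>I. {x \<in> A. (q, x) \<in> r}) \<noteq> {}" if I: "finite I" "I \<subseteq> A" for I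
      using finite_extremes(2)[of I] I A by (cases "I = {}") blast+
  qed
  then show "\<exists>m\<in>A. \<forall>y\<in>A. (y, m) \<in> r" by blast
qed

lemma first_point:
  assumes A: "compact A" "A \<noteq> {}" "A \<subseteq> \<sigma>"
  shows "first_point r A \<in> A" "y \<in> A \<Longrightarrow> (first_point r A, y) \<in> r"
proof -
  have "\<exists>!x. x \<in> A \<and> (\<forall>y\<in>A. (x, y) \<in> r)"
    using compact_extremes(1)[OF A] antisymD[OF r_antisym] by blast
  then have "first_point r A \<in> A \<and> (\<forall>y\<in>A. (first_point r A, y) \<in> r)"
    unfolding first_point_def by (rule theI')
  then show "first_point r A \<in> A" "y \<in> A \<Longrightarrow> (first_point r A, y) \<in> r" by auto
qed

lemma last_point:
  assumes A: "compact A" "A \<noteq> {}" "A \<subseteq> \<sigma>"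
  shows "last_point r A \<in> A" "y \<in> A \<Longrightarrow> (y, last_point r A) \<in> r"
proof -
  have "\<exists>!x. x \<in> A \<and> (\<forall>y\<in>A. (y, x) \<in> r)"
    using compact_extremes(2)[OF A] antisymD[OF r_antisym] by blast
  then have "last_point r A \<in> A \<and> (\<forall>y\<in>A. (y, last_point r A) \<in> r)"
    unfolding last_point_def by (rule theI')
  then show "last_point r A \<in> A" "y \<in> A \<Longrightarrow> (y, last_point r A) \<in> r" by auto
qed

definition len :: "plane set \<Rightarrow> real" where "len A = enn2real (curve_length r A)"

lemma curve_length_finite:
  assumes "A \<subseteq> \<sigma>" shows "curve_length r A = ennreal (len A)"
proof -
  obtain M where M: "\<forall>xs\<in>chains r \<sigma>. polygon_length xs \<le> M"
    using polygon_lengths_bounded[OF bdd dist_mono] by blast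
  have "curve_length r A \<le> curve_length r \<sigma>" by (rule curve_length_mono) (use assms in auto)
  also have "\<dots> \<le> ennreal M" unfolding curve_length_eq by (intro SUP_least ennreal_leI) (use M in auto)
  finally have "curve_length r A \<noteq> top" by (auto simp: top_unique)
  then show ?thesis unfolding len_def by (simp add: less_top)
qed

lemma len_nonneg: "len A \<ge> 0" by (simp add: len_def)

lemma polygon_le_len: "\<lbrakk>A \<subseteq> \<sigma>; xs \<in> chains r A\<rbrakk> \<Longrightarrow> polygon_length xs \<le> len A"
  using chain_le_curve_length[of xs r A] curve_length_finite[of A] len_nonneg by simp

lemma len_approx:
  assumes "A \<subseteq> \<sigma>" "e > 0"
  shows "\<exists>xs\<in>chains r A. len A - e < polygon_length xs"
proof (rule ccontr)
  assume "\<not> ?thesis"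
  then have le: "polygon_length xs \<le> len A - e" if "xs \<in> chains r A" for xs using that by force
  have "0 \<le> len A - e" using le[of "[]"] by simp
  moreover have "curve_length r A \<le> ennreal (len A - e)"
    unfolding curve_length_eq by (intro SUP_least ennreal_leI le)
  ultimately have "len A \<le> len A - e" using curve_length_finite[OF assms(1)] by simp
  then show False using assms(2) by simp
qed

lemma len_mono: "\<lbrakk>A \<subseteq> B; B \<subseteq> \<sigma>\<rbrakk> \<Longrightarrow> len A \<le> len B"
  using curve_length_mono[of A B r r] curve_length_finite[of A] curve_length_finite[of B] len_nonneg by auto

lemma len_split:
  assumes "A \<subseteq> \<sigma>" "p \<in> A"
  shows "len A = len {x \<in> A. (x, p) \<in> r} + len {x \<in> A. (p, x) \<in> r}"
proof -
  have sub: "{x \<in> A. P x} \<subseteq> \<sigma>" for P using assms(1) by blast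
  have "(x, p) \<in> r \<or> (p, x) \<in> r" if "x \<in> A" for x using r_total that assms by blast
  then have "ennreal (len A) = ennreal (len {x \<in> A. (x, p) \<in> r}) + ennreal (len {x \<in> A. (p, x) \<in> r})"
    using curve_length_split[OF r_trans assms(2)]
    unfolding curve_length_finite[OF assms(1)] curve_length_finite[OF sub] by blast
  then show ?thesis using len_nonneg by (simp flip: ennreal_plus)
qed

lemma len_singleton: "len {p} = 0"
proof -
  have "curve_length r {p} = 0"
    unfolding curve_length_eq by (auto simp: chains_def polygon_length_const intro!: SUP_eqI)
  then show ?thesis by (simp add: len_def)
qed

definition len_upto :: "plane set \<Rightarrow> plane \<Rightarrow> real" where "len_upto A p = len {x \<in> A. (x, p) \<in> r}"

lemma dist_le_len_upto_diff:
  assumes A: "A \<subseteq> \<sigma>" and p: "p \<in> A" "q \<in> A" "(p, q) \<in> r"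
  shows "norm (q - p) \<le> len_upto A q - len_upto A p"
proof -
  let ?B = "{x \<in> A. (x, q) \<in> r}"
  have "len ?B = len {x \<in> ?B. (x, p) \<in> r} + len {x \<in> ?B. (p, x) \<in> r}"
    using A p by (intro len_split) auto
  moreover have "{x \<in> ?B. (x, p) \<in> r} = {x \<in> A. (x, p) \<in> r}" using p(3) transD[OF r_trans] by blast
  moreover have "polygon_length [p, q] \<le> len {x \<in> ?B. (p, x) \<in> r}"
    using A p r_refl by (intro polygon_le_len) auto
  ultimately show ?thesis unfolding len_upto_def by simp
qed

text \<open>The length up to \<open>p\<close> and the length from \<open>p\<close> on are both lower semicontinuous, the latter
  by reversing the order, and their sum is the constant \<open>len A\<close>.\<close>
lemma continuous_on_len_upto:
  assumes A: "closed A" "A \<subseteq> \<sigma>"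
  shows "continuous_on A (len_upto A)"
  unfolding continuous_on_iff
proof (intro ballI allI impI)
  fix p and e :: real assume p: "p \<in> A" and e: "e > 0"
  have split: "len A = len_upto A q + len {x \<in> A. (q, x) \<in> r}" if "q \<in> A" for q
    using len_split[OF A(2) that] by (simp add: len_upto_def)
  have sub: "{x \<in> A. P x} \<subseteq> \<sigma>" for P using A by blast
  obtain xs where xs: "xs \<in> chains r {x \<in> A. (x, p) \<in> r}" "len_upto A p - e / 2 < polygon_length xs"
    using len_approx[OF sub half_gt_zero[OF e], of "\<lambda>x. (x, p) \<in> r"] unfolding len_upto_def by blast
  obtain ys where ys: "ys \<in> chains r {x \<in> A. (p, x) \<in> r}" "len {x \<in> A. (p, x) \<in> r} - e / 2 < polygon_length ys"
    using len_approx[OF sub half_gt_zero[OF e], of "\<lambda>x. (p, x) \<in> r"] by blast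
  have tot: "(x, y) \<in> r \<or> (y, x) \<in> r" if "x \<in> A" "y \<in> A" for x y using r_total that A(2) by blast
  have cl: "closed {x \<in> A. (x, q) \<in> r}" "closed {x \<in> A. (q, x) \<in> r}" if "q \<in> A" for q
    using closed_below closed_above A that by blast+
  obtain d1 where d1: "d1 > 0" "\<forall>q\<in>A. norm (q - p) < d1 \<longrightarrow>
      (\<exists>zs\<in>chains r {x \<in> A. (x, q) \<in> r}. polygon_length xs - e / 2 < polygon_length zs)"
    using polygon_length_lower_semicontinuous[OF r_trans r_antisym tot cl(1) p xs(1), of "e / 2"] e by auto
  have "rev ys \<in> chains (r\<inverse>) {x \<in> A. (x, p) \<in> r\<inverse>}" using ys(1) by (simp add: chains_converse)
  then obtain d2 where d2: "d2 > 0" "\<forall>q\<in>A. norm (q - p) < d2 \<longrightarrow>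
      (\<exists>zs\<in>chains (r\<inverse>) {x \<in> A. (x, q) \<in> r\<inverse>}. polygon_length (rev ys) - e / 2 < polygon_length zs)"
    using polygon_length_lower_semicontinuous[of "r\<inverse>" A p "rev ys" "e / 2"] r_trans r_antisym tot cl(2) p e
    by auto
  show "\<exists>d>0. \<forall>q\<in>A. dist q p < d \<longrightarrow> dist (len_upto A q) (len_upto A p) < e"
  proof (intro exI[of _ "min d1 d2"] conjI ballI impI)
    fix q assume q: "q \<in> A" "dist q p < min d1 d2"
    then obtain zs where zs: "zs \<in> chains r {x \<in> A. (x, q) \<in> r}" "polygon_length xs - e / 2 < polygon_length zs"
      using d1 by (auto simp: dist_norm)
    obtain ws where ws: "ws \<in> chains (r\<inverse>) {x \<in> A. (x, q) \<in> r\<inverse>}" "polygon_length (rev ys) - e / 2 < polygon_length ws"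
      using d2 q by (auto simp: dist_norm)
    have "polygon_length zs \<le> len_upto A q"
      unfolding len_upto_def using zs(1) A by (intro polygon_le_len) auto
    moreover have "polygon_length (rev ws) \<le> len {x \<in> A. (q, x) \<in> r}"
      using ws(1) A by (intro polygon_le_len) (auto simp: chains_converse)
    ultimately show "dist (len_upto A q) (len_upto A p) < e"
      using xs(2) ys(2) zs(2) ws(2) split[OF p] split[OF q(1)]
      by (simp add: polygon_length_rev dist_real_def abs_if)
  qed (use d1 d2 in auto)
qed

lemma len_upto_image:
  assumes A: "compact A" "connected A" "A \<noteq> {}" "A \<subseteq> \<sigma>"
  shows "len_upto A ` A = {0..len A}"
proof
  have "closed A" using A(1) compact_imp_closed by blast
  then have conn: "connected (len_upto A ` A)"
    using A continuous_on_len_upto by (intro connected_continuous_image) auto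
  obtain a where a: "a \<in> A" "\<And>x. x \<in> A \<Longrightarrow> (a, x) \<in> r" using compact_extremes(1)[OF A(1,3,4)] by blast
  obtain b where b: "b \<in> A" "\<And>x. x \<in> A \<Longrightarrow> (x, b) \<in> r" using compact_extremes(2)[OF A(1,3,4)] by blast
  have "{x \<in> A. (x, a) \<in> r} = {a}" using a antisymD[OF r_antisym] by blast
  then have "0 \<in> len_upto A ` A" using a(1) len_singleton by (auto simp: len_upto_def image_iff intro!: bexI[of _ a])
  moreover have "{x \<in> A. (x, b) \<in> r} = A" using b by blast
  then have "len A \<in> len_upto A ` A" using b(1) by (auto simp: len_upto_def image_iff intro!: bexI[of _ b])
  ultimately show "{0..len A} \<subseteq> len_upto A ` A" using connected_contains_Icc[OF conn] by blast
  show "len_upto A ` A \<subseteq> {0..len A}"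
    using A(4) len_nonneg by (auto simp: len_upto_def intro!: len_mono)
qed

lemma arclength_param_len_upto:
  assumes A: "A \<subseteq> \<sigma>" and p: "p \<in> A"
  shows "arclength_param r A (len_upto A p) = p"
  unfolding arclength_param_def
proof (rule the_equality)
  show "p \<in> A \<and> curve_length r {q \<in> A. (q, p) \<in> r} = ennreal (len_upto A p)"
    using p A curve_length_finite[of "{q \<in> A. (q, p) \<in> r}"] by (auto simp: len_upto_def)
  fix q assume q: "q \<in> A \<and> curve_length r {x \<in> A. (x, q) \<in> r} = ennreal (len_upto A p)"
  then have "len_upto A q = len_upto A p"
    using A unfolding len_upto_def len_def[of "{x \<in> A. (x, q) \<in> r}"] by (simp add: len_nonneg)
  then show "q = p"
    using dist_le_len_upto_diff[OF A, of p q] dist_le_len_upto_diff[OF A, of q p] r_total q p A by auto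
qed

text \<open>The meaning of \<open>\<HH>\<close>. The squared distance from \<open>y\<close> along the arc-length parametrization is Lipschitz, and where
  the parametrization is differentiable the condition defining \<open>\<HH>\<close> makes its derivative
  nonnegative.\<close>
lemma distance_nondecreasing_of_\<HH>:
  assumes A: "compact A" "connected A" "A \<subseteq> \<sigma>"
    and y: "y \<in> \<HH> r A (first_point r A)" and ab: "a \<in> A" "b \<in> A" "(a, b) \<in> r"
  shows "norm (a - y) \<le> norm (b - y)"
proof -
  let ?L = "len A" and ?x = "arclength_param r A"
  have ne: "A \<noteq> {}" using ab by blast
  have x: "?x t \<in> A" "len_upto A (?x t) = t" if "t \<in> {0..?L}" for t
  proof -
    obtain p where "p \<in> A" "t = len_upto A p" using len_upto_image[OF A(1,2) ne A(3)] \<open>t \<in> {0..?L}\<close> by blast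
    then show "?x t \<in> A" "len_upto A (?x t) = t" using arclength_param_len_upto[OF A(3)] by auto
  qed
  have xlip: "norm (?x s - ?x t) \<le> \<bar>s - t\<bar>" if st: "s \<in> {0..?L}" "t \<in> {0..?L}" for s t
  proof -
    have "(?x s, ?x t) \<in> r \<or> (?x t, ?x s) \<in> r" using x(1) st r_total A(3) by blast
    then show ?thesis
      using dist_le_len_upto_diff[OF A(3) x(1)[OF st(1)] x(1)[OF st(2)]]
        dist_le_len_upto_diff[OF A(3) x(1)[OF st(2)] x(1)[OF st(1)]] x(2)[OF st(1)] x(2)[OF st(2)]
      by (auto simp: norm_minus_commute)
  qed
  have L: "?L \<ge> 0" by (rule len_nonneg)
  \<comment> \<open>The extension by constants to the real line is again 1-Lipschitz.\<close>
  define X where "X t = ?x (max 0 (min ?L t))" for t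
  have X: "X t = ?x t" if "t \<in> {0..?L}" for t using that by (simp add: X_def)
  have "1-lipschitz_on UNIV X"
  proof (rule lipschitz_onI)
    fix s t :: real
    have "norm (X s - X t) \<le> \<bar>max 0 (min ?L s) - max 0 (min ?L t)\<bar>"
      unfolding X_def using L by (intro xlip) auto
    also have "\<dots> \<le> \<bar>s - t\<bar>" by linarith
    finally show "dist (X s) (X t) \<le> 1 * dist s t" by (simp add: dist_norm)
  qed simp
  then have N: "negligible {t. \<not> X differentiable at t}" by (rule negligible_nondifferentiable_lipschitz)
  define s0 t0 where "s0 = len_upto A a" and "t0 = len_upto A b"
  have st: "0 \<le> s0" "s0 \<le> t0" "t0 \<le> ?L" and xs: "?x s0 = a" "?x t0 = b"
  proof -
    show "s0 \<le> t0" using dist_le_len_upto_diff[OF A(3) ab] by (simp add: s0_def t0_def) (meson diff_ge_0_iff_ge norm_ge_zero order_trans)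
    show "0 \<le> s0" "t0 \<le> ?L" using len_upto_image[OF A(1,2) ne A(3)] ab by (auto simp: s0_def t0_def)
    show "?x s0 = a" "?x t0 = b" using arclength_param_len_upto[OF A(3)] ab by (auto simp: s0_def t0_def)
  qed
  define f where "f t = (?x t - y) \<bullet> (?x t - y)" for t
  obtain R where R: "\<And>p. p \<in> A \<Longrightarrow> norm (p - y) \<le> R" "R \<ge> 0"
  proof -
    obtain R where R: "\<forall>p\<in>A. norm p \<le> R" using compact_imp_bounded[OF A(1)] by (auto simp: bounded_iff)
    have "norm (p - y) \<le> \<bar>R\<bar> + norm y" if "p \<in> A" for p
      using R that norm_triangle_ineq4[of p y] by force
    then show ?thesis by (intro that[of "\<bar>R\<bar> + norm y"]) auto
  qed
  have "f s0 \<le> f t0"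
  proof (rule ae_nondecreasing_imp_le[OF st(2) _ N])
    show "(2 * R)-lipschitz_on {s0..t0} f"
    proof (rule lipschitz_onI)
      fix s t assume "s \<in> {s0..t0}" "t \<in> {s0..t0}"
      then have st': "s \<in> {0..?L}" "t \<in> {0..?L}" using st by auto
      have "f s - f t = (?x s - ?x t) \<bullet> ((?x s - y) + (?x t - y))"
      proof -
        have "p \<bullet> p - q \<bullet> q = (p - q) \<bullet> (p + q)" for p q :: plane
          by (simp add: inner_diff_left inner_add_right inner_commute[of q p])
        from this[of "?x s - y" "?x t - y"] show ?thesis by (simp add: f_def)
      qed
      also have "\<bar>\<dots>\<bar> \<le> norm (?x s - ?x t) * norm ((?x s - y) + (?x t - y))" by (rule Cauchy_Schwarz_ineq2)
      also have "\<dots> \<le> \<bar>s - t\<bar> * (R + R)"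
        using xlip[OF st'] R(1)[OF x(1)[OF st'(1)]] R(1)[OF x(1)[OF st'(2)]]
        by (intro mult_mono norm_triangle_mono) auto
      finally show "dist (f s) (f t) \<le> 2 * R * dist s t" by (simp add: dist_real_def algebra_simps)
    qed (use R(2) in simp)
  next
    fix t e :: real assume t: "s0 \<le> t" "t < t0" "t \<notin> {t. \<not> X differentiable at t}" and e: "e > 0"
    let ?T = "{0..?L}"
    have tT: "t \<in> ?T" using t st by simp
    obtain v where "(X has_vector_derivative v) (at t)" using t(3) vector_derivative_works by auto
    then have "(X has_vector_derivative v) (at t within ?T)" by (rule has_vector_derivative_at_within)
    then have v: "(?x has_vector_derivative v) (at t within ?T)"
      by (rule has_vector_derivative_transform[OF tT, rotated]) (simp add: X)
    moreover have "(first_point r A, ?x t) \<in> r" using first_point(2)[OF A(1) ne A(3)] x(1)[OF tT] by blast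
    ultimately have "v \<bullet> (y - ?x t) \<le> 0"
      using y tT unfolding \<HH>_def Let_def len_def[symmetric] by blast
    then have D: "2 * ((?x t - y) \<bullet> v) \<ge> 0" by (simp add: inner_diff_left inner_diff_right inner_commute)
    have "(f has_derivative (\<lambda>h. h * (2 * ((?x t - y) \<bullet> v)))) (at t within ?T)"
      unfolding f_def using v unfolding has_vector_derivative_def
      by (auto intro!: derivative_eq_intros simp: inner_commute fun_eq_iff)
    then obtain d where d: "d > 0"
      "\<And>s. \<lbrakk>s \<in> ?T; norm (s - t) < d\<rbrakk> \<Longrightarrow> norm (f s - f t - (s - t) * (2 * ((?x t - y) \<bullet> v))) \<le> e * norm (s - t)"
      using e unfolding has_derivative_within_alt by blast
    have "f t - e * (s - t) \<le> f s" if s: "t < s" "s < t + d" "s \<le> t0" for s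
    proof -
      have "\<bar>f s - f t - (s - t) * (2 * ((?x t - y) \<bullet> v))\<bar> \<le> e * (s - t)"
        using d(2)[of s] s t st by auto
      moreover have "(s - t) * (2 * ((?x t - y) \<bullet> v)) \<ge> 0" using D s by (intro mult_nonneg_nonneg) auto
      ultimately show ?thesis by linarith
    qed
    then show "\<exists>d>0. \<forall>s. t < s \<and> s < t + d \<and> s \<le> t0 \<longrightarrow> f t - e * (s - t) \<le> f s" using d(1) by blast
  qed
  then show ?thesis unfolding f_def xs by (simp add: norm_le)
qed

end

section \<open>Gluing self-distancing sets\<close>
lemma self_distancing_restrict:
  assumes "self_distancing \<sigma> r" "A \<subseteq> \<sigma>"
  shows "self_distancing A (r \<inter> A \<times> A)"
proof -
  interpret self_distancing_set \<sigma> r by standard (rule assms)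
  have "linear_order_on A (r \<inter> A \<times> A)"
    unfolding order_on_defs refl_on_def total_on_def trans_def antisym_def
    using r_refl r_total transD[OF r_trans] antisymD[OF r_antisym] assms(2) by blast
  moreover have "bounded A" using bdd assms(2) bounded_subset by blast
  ultimately show ?thesis unfolding self_distancing_def using dist_mono by blast
qed

definition glue :: "'a set \<Rightarrow> 'a rel \<Rightarrow> 'a set \<Rightarrow> 'a rel \<Rightarrow> 'a rel" where
  "glue A r B s = r \<union> s \<union> A \<times> B"

locale gluable =
  a: self_distancing_set A r + b: self_distancing_set B s for A r B s +
  fixes p :: plane
  assumes pA: "p \<in> A" and last: "x \<in> A \<Longrightarrow> (x, p) \<in> r"
    and pB: "p \<in> B" and first: "y \<in> B \<Longrightarrow> (p, y) \<in> s"
    and far: "\<lbrakk>x \<in> A; (y, z) \<in> s\<rbrakk> \<Longrightarrow> norm (y - x) \<le> norm (z - x)"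
begin

text \<open>Along \<open>B\<close> the distance from a common point \<open>x\<close> is at least its value at \<open>p\<close>, and it vanishes at \<open>x\<close>.\<close>
lemma Int_eq: "A \<inter> B = {p}"
proof -
  have "x = p" if "x \<in> A" "x \<in> B" for x
    using far[OF that(1) first[OF that(2)]] by simp
  then show ?thesis using pA pB by blast
qed

lemma glue_on_left: "\<lbrakk>x \<in> A; y \<in> A\<rbrakk> \<Longrightarrow> (x, y) \<in> glue A r B s \<longleftrightarrow> (x, y) \<in> r"
  and glue_on_right: "\<lbrakk>x \<in> B; y \<in> B\<rbrakk> \<Longrightarrow> (x, y) \<in> glue A r B s \<longleftrightarrow> (x, y) \<in> s"
proof -
  have eq: "x = p" if "x \<in> A" "x \<in> B" for x using Int_eq that by blast
  show "(x, y) \<in> glue A r B s \<longleftrightarrow> (x, y) \<in> r" if "x \<in> A" "y \<in> A"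
    using that b.r_carrier[of x y] eq[of x] eq[of y] last unfolding glue_def by auto
  show "(x, y) \<in> glue A r B s \<longleftrightarrow> (x, y) \<in> s" if "x \<in> B" "y \<in> B"
    using that a.r_carrier[of x y] eq[of x] eq[of y] first unfolding glue_def by auto
qed

lemma glue_cases:
  assumes "(x, y) \<in> glue A r B s"
  obtains "x \<in> A" "y \<in> A" "(x, y) \<in> r" | "x \<in> B" "y \<in> B" "(x, y) \<in> s" | "x \<in> A" "y \<in> B"
  using assms a.r_carrier b.r_carrier unfolding glue_def by blast

text \<open>The pieces meet only in \<open>p\<close>, so the order never returns from \<open>B\<close> to \<open>A\<close>. The distance from a point of
  \<open>A\<close> is nondecreasing up to \<open>p\<close> by self-distancing of \<open>A\<close> and from there on by assumption.\<close>
lemma self_distancing_glue: "self_distancing (A \<union> B) (glue A r B s)"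
proof -
  let ?g = "glue A r B s"
  have r: "(x, y) \<in> r \<Longrightarrow> (x, y) \<in> ?g" and s: "(x, y) \<in> s \<Longrightarrow> (x, y) \<in> ?g"
    and AB: "\<lbrakk>x \<in> A; y \<in> B\<rbrakk> \<Longrightarrow> (x, y) \<in> ?g" for x y
    by (auto simp: glue_def)
  have eq: "x = p" if "x \<in> A" "x \<in> B" for x using Int_eq that by blast
  have "trans ?g"
  proof (rule transI)
    fix x y z assume xy: "(x, y) \<in> ?g" and yz: "(y, z) \<in> ?g"
    show "(x, z) \<in> ?g" using xy
    proof (cases rule: glue_cases)
      case 1
      from yz show ?thesis
        by (cases rule: glue_cases) (use 1 transD[OF a.r_trans] r AB in blast)+
    next
      case 2
      from yz show ?thesis
      proof (cases rule: glue_cases)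
        case yz1: 1
        then have "y = p" using 2 eq by blast
        then have "x = p" using 2 first antisymD[OF b.r_antisym] by blast
        then show ?thesis using yz \<open>y = p\<close> by simp
      next
        case yz2: 2
        then show ?thesis using 2 transD[OF b.r_trans] s by blast
      next
        case yz3: 3
        then have "y = p" using 2 eq by blast
        then have "x = p" using 2 first antisymD[OF b.r_antisym] by blast
        then show ?thesis using yz \<open>y = p\<close> by simp
      qed
    next
      case 3
      from yz show ?thesis
      proof (cases rule: glue_cases)
        case yz1: 1
        then have "y = p" using 3 eq by blast
        then have "z = p" using yz1 last antisymD[OF a.r_antisym] by blast
        then show ?thesis using xy \<open>y = p\<close> by simp
      qed (use 3 AB in auto)
    qed
  qed
  moreover have "antisym ?g"
  proof (rule antisymI)
    have *: "x = y" if "x \<in> A" "y \<in> B" "(y, x) \<in> ?g" for x y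
      using that(3)
    proof (cases rule: glue_cases)
      case 1
      then have "y = p" using that eq by blast
      then show ?thesis using 1 last antisymD[OF a.r_antisym] by blast
    next
      case 2
      then have "x = p" using that eq by blast
      then show ?thesis using 2 first antisymD[OF b.r_antisym] by blast
    next
      case 3
      then show ?thesis using that eq by blast
    qed
    fix x y assume xy: "(x, y) \<in> ?g" and yx: "(y, x) \<in> ?g"
    show "x = y" using xy
    proof (cases rule: glue_cases)
      case 1
      then show ?thesis using yx glue_on_left antisymD[OF a.r_antisym] by blast
    next
      case 2
      then show ?thesis using yx glue_on_right antisymD[OF b.r_antisym] by blast
    qed (use * yx in blast)
  qed
  moreover have "?g \<subseteq> (A \<union> B) \<times> (A \<union> B)" using a.r_carrier b.r_carrier by (auto simp: glue_def)
  moreover have "refl_on (A \<union> B) ?g" using a.r_refl b.r_refl by (auto simp: refl_on_def glue_def)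
  moreover have "total_on (A \<union> B) ?g" using a.r_total b.r_total by (auto simp: total_on_def glue_def)
  moreover have "norm (y - x) \<le> norm (z - x)" if xy: "(x, y) \<in> ?g" and yz: "(y, z) \<in> ?g" for x y z
  proof -
    have via: "norm (y - x) \<le> norm (z - x)" if "x \<in> A" "y \<in> A" "(x, y) \<in> r" "z \<in> B" for x y z
      using a.dist_mono[OF that(3) last[OF that(2)]] far[OF that(1) first[OF that(4)]] by simp
    show ?thesis using xy
    proof (cases rule: glue_cases)
      case 1
      from yz show ?thesis
      proof (cases rule: glue_cases)
        case yz1: 1
        then show ?thesis using 1 a.dist_mono by blast
      next
        case yz2: 2
        then show ?thesis using 1 via by blast
      next
        case yz3: 3
        then show ?thesis using 1 via by blast
      qed
    next
      case 2
      then have "y \<in> A \<Longrightarrow> x = y" using eq first antisymD[OF b.r_antisym] by blast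
      with yz show ?thesis by (cases rule: glue_cases) (use 2 b.dist_mono in auto)
    next
      case 3
      from yz show ?thesis
      proof (cases rule: glue_cases)
        case yz1: 1
        then have "y = p" using 3 eq by blast
        then have "z = y" using yz1 last antisymD[OF a.r_antisym] by blast
        then show ?thesis by simp
      next
        case yz2: 2
        then show ?thesis using 3 far by blast
      next
        case yz3: 3
        then have "y = p" using 3 eq by blast
        then show ?thesis using far[OF 3(1) first[OF yz3(2)]] by simp
      qed
    qed
  qed
  moreover have "bounded (A \<union> B)" using a.bdd b.bdd by simp
  ultimately show ?thesis unfolding self_distancing_def order_on_defs by blast
qed

lemma curve_length_glue: "curve_length (glue A r B s) (A \<union> B) = curve_length r A + curve_length s B"
proof -
  interpret g: self_distancing_set "A \<union> B" "glue A r B s" by standard (rule self_distancing_glue)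
  let ?g = "glue A r B s"
  have A: "{x \<in> A \<union> B. (x, p) \<in> ?g} = A"
    using last first pA antisymD[OF g.r_antisym] by (auto simp: glue_def)
  have B: "{x \<in> A \<union> B. (p, x) \<in> ?g} = B"
    using last first pB antisymD[OF g.r_antisym] by (auto simp: glue_def)
  have "curve_length ?g (A \<union> B) = curve_length ?g A + curve_length ?g B"
    using curve_length_split[OF g.r_trans, of p "A \<union> B"] g.r_total pA A B by auto
  also have "curve_length ?g A = curve_length r A" by (rule curve_length_cong) (rule glue_on_left)
  also have "curve_length ?g B = curve_length s B" by (rule curve_length_cong) (rule glue_on_right)
  finally show ?thesis .
qed

end

definition segment_order :: "plane \<Rightarrow> plane \<Rightarrow> plane rel" where
  "segment_order a b = {(x, y). x \<in> closed_segment a b \<and> y \<in> closed_segment a b \<and> norm (x - a) \<le> norm (y - a)}"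

lemma segment_distance:
  assumes "x \<in> closed_segment a b" "y \<in> closed_segment a b" "norm (x - a) \<le> norm (y - a)"
  shows "norm (y - x) = norm (y - a) - norm (x - a)"
proof -
  obtain t where t: "x = a + t *\<^sub>R (b - a)" "0 \<le> t" using assms(1) by (auto simp: closed_segment_def algebra_simps)
  obtain u where u: "y = a + u *\<^sub>R (b - a)" "0 \<le> u" using assms(2) by (auto simp: closed_segment_def algebra_simps)
  show ?thesis
  proof (cases "b = a")
    case False
    then have "t \<le> u" using assms(3) t u by simp
    moreover have "y - x = (u - t) *\<^sub>R (b - a)" unfolding t(1) u(1) by (simp add: algebra_simps)
    moreover have "norm (y - a) = u * norm (b - a)" "norm (x - a) = t * norm (b - a)"
      unfolding t(1) u(1) using t(2) u(2) by simp_all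
    ultimately show ?thesis by (simp add: left_diff_distrib)
  qed (use t u in simp)
qed

lemma self_distancing_segment: "self_distancing (closed_segment a b) (segment_order a b)"
proof -
  have "x = y" if "(x, y) \<in> segment_order a b" "(y, x) \<in> segment_order a b" for x y
    using segment_distance[of x a b y] that unfolding segment_order_def by auto
  then have "linear_order_on (closed_segment a b) (segment_order a b)"
    unfolding order_on_defs refl_on_def total_on_def
    by (auto simp: segment_order_def intro!: transI antisymI)
  moreover have "norm (y - x) \<le> norm (z - x)"
    if "(x, y) \<in> segment_order a b" "(y, z) \<in> segment_order a b" for x y z
    using segment_distance[of x a b y] segment_distance[of x a b z] that unfolding segment_order_def by auto
  ultimately show ?thesis unfolding self_distancing_def by (auto intro: compact_imp_bounded)
qed

lemma runs_along_segment_if_segment_order: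
  assumes "linear_order_on \<gamma> s" "segment_order a b \<subseteq> s"
  shows "runs_along_segment s a b"
  unfolding runs_along_segment_def
proof (intro ballI iffI)
  fix x y assume x: "x \<in> closed_segment a b" and y: "y \<in> closed_segment a b"
  show "norm (x - a) \<le> norm (y - a) \<Longrightarrow> (x, y) \<in> s" using assms(2) x y unfolding segment_order_def by auto
  assume "(x, y) \<in> s"
  moreover have "norm (y - a) < norm (x - a) \<Longrightarrow> (y, x) \<in> s"
    using assms(2) x y unfolding segment_order_def by auto
  moreover have "antisym s" using assms(1) by (simp add: order_on_defs)
  ultimately show "norm (x - a) \<le> norm (y - a)" using antisymD by fastforce
qed

lemma curve_length_segment_le: "curve_length (segment_order a b) (closed_segment a b) \<le> ennreal (norm (b - a))"
  unfolding curve_length_eq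
proof (intro SUP_least ennreal_leI)
  fix xs assume xs: "xs \<in> chains (segment_order a b) (closed_segment a b)"
  have "polygon_length xs \<le> norm (last xs - a) - norm (hd xs - a)"
    if "xs \<in> chains (segment_order a b) (closed_segment a b)" "xs \<noteq> []" for xs
    using that
  proof (induction xs rule: polygon_length.induct)
    case (1 x y xs)
    then have "norm (y - x) = norm (y - a) - norm (x - a)"
      by (intro segment_distance[of _ _ b]) (auto simp: segment_order_def)
    then show ?case using 1 by auto
  qed auto
  note telescope = this
  show "polygon_length xs \<le> norm (b - a)"
  proof (cases "xs = []")
    case False
    have "norm (last xs - a) \<le> norm (b - a)"
      using xs segment_bound(1)[of "last xs" a b] last_in_set[OF False] unfolding chains_def by blast
    then show ?thesis using telescope[OF xs False] norm_ge_zero[of "hd xs - a"] by linarith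
  qed simp
qed

text \<open>For \<open>x = a + t *\<^sub>R (b - a)\<close> the squared distance from \<open>q\<close> is a polynomial in \<open>t\<close> whose coefficients
  at \<open>t\<close> and \<open>t\<^sup>2\<close> are nonnegative.\<close>
lemma distance_nondecreasing_along_segment:
  assumes obt: "(b - a) \<bullet> (q - a) \<le> 0" and xy: "(x, y) \<in> segment_order a b"
  shows "norm (x - q) \<le> norm (y - q)"
proof -
  obtain t where t: "x = a + t *\<^sub>R (b - a)" "0 \<le> t"
    using xy by (auto simp: segment_order_def closed_segment_def algebra_simps)
  obtain u where u: "y = a + u *\<^sub>R (b - a)" "0 \<le> u"
    using xy by (auto simp: segment_order_def closed_segment_def algebra_simps)
  show ?thesis
  proof (cases "b = a")
    case False
    then have tu: "t \<le> u" using xy t u by (simp add: segment_order_def)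
    let ?d = "b - a"
    have sq: "(a + c *\<^sub>R ?d - q) \<bullet> (a + c *\<^sub>R ?d - q) =
        (a - q) \<bullet> (a - q) + 2 * (c * (- (?d \<bullet> (q - a)))) + c * c * (?d \<bullet> ?d)" for c
    proof -
      have "a + c *\<^sub>R ?d - q = (a - q) + c *\<^sub>R ?d" by simp
      moreover have "?d \<bullet> (q - a) = - (?d \<bullet> (a - q))" by (simp add: inner_diff_right)
      ultimately show ?thesis
        by (simp only: inner_add_left[of "a - q"] inner_add_right[of _ "a - q"])
           (simp add: inner_commute[of ?d "a - q"])
    qed
    have "t * (- (?d \<bullet> (q - a))) \<le> u * (- (?d \<bullet> (q - a)))" using obt tu by (intro mult_right_mono) auto
    moreover have "t * t * (?d \<bullet> ?d) \<le> u * u * (?d \<bullet> ?d)" using t(2) tu by (intro mult_right_mono mult_mono) auto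
    ultimately show ?thesis unfolding norm_le t(1) u(1) sq by linarith
  qed (use t u in simp)
qed

text \<open>After squaring, the quadratic terms in \<open>a\<close> cancel, which leaves a linear inequality.\<close>
lemma convex_no_farther: "convex {a::'a::real_inner. norm (x - a) \<le> norm (y - a)}"
proof -
  have "norm (x - a) \<le> norm (y - a) \<longleftrightarrow> (2 *\<^sub>R (y - x)) \<bullet> a \<le> y \<bullet> y - x \<bullet> x" for a
    by (simp add: norm_le inner_diff_left inner_diff_right inner_commute algebra_simps)
  then have "{a. norm (x - a) \<le> norm (y - a)} = {a. (2 *\<^sub>R (y - x)) \<bullet> a \<le> y \<bullet> y - x \<bullet> x}" by blast
  then show ?thesis using convex_halfspace_le[of "2 *\<^sub>R (y - x)" "y \<bullet> y - x \<bullet> x"] by argo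
qed

section \<open>Increasing unions and closures\<close>
lemma self_distancing_directed_Union:
  fixes A :: "nat \<Rightarrow> plane set"
  assumes "I \<noteq> {}" and sd: "\<And>n. n \<in> I \<Longrightarrow> self_distancing (A n) (R n)"
    and mono: "\<And>m n. \<lbrakk>m \<le> n; n \<in> I\<rbrakk> \<Longrightarrow> A m \<subseteq> A n \<and> R m \<subseteq> R n"
    and bdd: "bounded (\<Union>n\<in>I. A n)"
  shows "self_distancing (\<Union>n\<in>I. A n) (\<Union>n\<in>I. R n)"
proof -
  let ?A = "\<Union>n\<in>I. A n" and ?R = "\<Union>n\<in>I. R n"
  have lin: "refl_on (A n) (R n)" "trans (R n)" "antisym (R n)" "total_on (A n) (R n)" "R n \<subseteq> A n \<times> A n"
    if "n \<in> I" for n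
    using sd[OF that] unfolding self_distancing_def order_on_defs by auto
  have two: "\<exists>n\<in>I. e \<in> R n \<and> f \<in> R n" if ef: "e \<in> ?R" "f \<in> ?R" for e f
  proof -
    obtain m n where "m \<in> I" "n \<in> I" "e \<in> R m" "f \<in> R n" using ef by blast
    then show ?thesis using mono[of m n] mono[of n m] by (cases "m \<le> n") auto
  qed
  have "trans ?R"
  proof (rule transI)
    fix x y z assume "(x, y) \<in> ?R" "(y, z) \<in> ?R"
    then obtain n where n: "n \<in> I" "(x, y) \<in> R n" "(y, z) \<in> R n" using two by blast
    then have "(x, z) \<in> R n" using transD[OF lin(2)] by blast
    then show "(x, z) \<in> ?R" using n(1) by blast
  qed
  moreover have "antisym ?R"
  proof (rule antisymI)
    fix x y assume "(x, y) \<in> ?R" "(y, x) \<in> ?R"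
    then obtain n where "n \<in> I" "(x, y) \<in> R n" "(y, x) \<in> R n" using two by blast
    then show "x = y" using lin(3) antisymD by metis
  qed
  moreover have "total_on ?A ?R"
    unfolding total_on_def
  proof (intro ballI impI)
    fix x y assume x: "x \<in> ?A" and y: "y \<in> ?A" and "x \<noteq> y"
    obtain m n where "m \<in> I" "n \<in> I" "x \<in> A m" "y \<in> A n" using x y by blast
    then obtain k where "k \<in> I" "x \<in> A k" "y \<in> A k" using mono[of m n] mono[of n m] by (cases "m \<le> n") auto
    then show "(x, y) \<in> ?R \<or> (y, x) \<in> ?R" using lin(4)[of k] \<open>x \<noteq> y\<close> unfolding total_on_def by blast
  qed
  moreover have "refl_on ?A ?R" using lin(1) unfolding refl_on_def by blast
  moreover have "?R \<subseteq> ?A \<times> ?A" using lin(5) by blast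
  moreover have "norm (y - x) \<le> norm (z - x)" if xyz: "(x, y) \<in> ?R" "(y, z) \<in> ?R" for x y z
  proof -
    obtain n where "n \<in> I" "(x, y) \<in> R n" "(y, z) \<in> R n" using two xyz by blast
    then show ?thesis using sd unfolding self_distancing_def by blast
  qed
  ultimately show ?thesis unfolding self_distancing_def order_on_defs using bdd by blast
qed

context self_distancing_set
begin

text \<open>A new limit point \<open>z\<close> has positive distance from the closed initial segment up to \<open>q\<close>, so all points
  of \<open>\<sigma>\<close> near \<open>z\<close> come after \<open>q\<close>.\<close>
lemma near_limit_late:
  assumes cl: "closed {x \<in> \<sigma>. (x, q) \<in> r}" and q: "q \<in> \<sigma>" and z: "z \<in> closure \<sigma> - \<sigma>" and e: "e > 0"
  shows "\<exists>x\<in>\<sigma>. norm (x - z) < e \<and> (q, x) \<in> r"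
proof -
  have "open (- {x \<in> \<sigma>. (x, q) \<in> r})" "z \<in> - {x \<in> \<sigma>. (x, q) \<in> r}" using cl z by auto
  then obtain d where d: "d > 0" "ball z d \<subseteq> - {x \<in> \<sigma>. (x, q) \<in> r}" using open_contains_ball by meson
  obtain x where x: "x \<in> \<sigma>" "dist x z < min d e"
    using z d(1) e closure_approachable[of z \<sigma>] by (metis DiffD1 min_less_iff_conj)
  then have "x \<in> ball z d" by (simp add: dist_commute)
  then have "(x, q) \<notin> r" using d(2) x(1) by blast
  then show ?thesis using x r_total[OF x(1) q] by (auto simp: dist_norm)
qed

text \<open>New limit points come last. The product relates them also to each other, which is harmless since
  there is at most one of them.\<close>
definition closure_order :: "plane rel" where
  "closure_order = r \<union> closure \<sigma> \<times> (closure \<sigma> - \<sigma>)"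

context
  assumes cl: "\<And>q. q \<in> \<sigma> \<Longrightarrow> closed {x \<in> \<sigma>. (x, q) \<in> r}"
begin

text \<open>With \<open>x1 \<preceq> x2 \<preceq> x3\<close>, \<open>x1\<close> and \<open>x3\<close> near \<open>z\<close> and \<open>x2\<close> near \<open>w\<close>, self-distancing would make
  \<open>norm (x2 - x1)\<close>, about the distance of \<open>z\<close> and \<open>w\<close>, at most the small \<open>norm (x3 - x1)\<close>.\<close>
lemma new_limit_unique:
  assumes z: "z \<in> closure \<sigma> - \<sigma>" and w: "w \<in> closure \<sigma> - \<sigma>"
  shows "z = w"
proof (rule ccontr)
  assume "z \<noteq> w"
  define e where "e = norm (w - z) / 4"
  have e: "e > 0" using \<open>z \<noteq> w\<close> by (simp add: e_def)
  obtain x1 where x1: "x1 \<in> \<sigma>" "norm (x1 - z) < e"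
    using z e closure_approachable[of z \<sigma>] by (metis DiffD1 dist_norm)
  obtain x2 where x2: "x2 \<in> \<sigma>" "norm (x2 - w) < e" "(x1, x2) \<in> r"
    using near_limit_late[OF cl[OF x1(1)] x1(1) w e] by blast
  obtain x3 where x3: "x3 \<in> \<sigma>" "norm (x3 - z) < e" "(x2, x3) \<in> r"
    using near_limit_late[OF cl[OF x2(1)] x2(1) z e] by blast
  have "norm (x3 - x1) \<le> norm (x3 - z) + norm (x1 - z)"
    using norm_triangle_ineq4[of "x3 - z" "x1 - z"] by simp
  moreover have "norm (w - z) \<le> norm (x2 - w) + norm (x2 - x1) + norm (x1 - z)"
  proof -
    have "w - z = (x2 - x1) + ((x1 - z) - (x2 - w))" by simp
    then have "norm (w - z) \<le> norm (x2 - x1) + norm ((x1 - z) - (x2 - w))" by (metis norm_triangle_ineq)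
    then show ?thesis using norm_triangle_ineq4[of "x1 - z" "x2 - w"] by simp
  qed
  ultimately show False
    using dist_mono[OF x2(3) x3(3)] x1(2) x2(2) x3(2) unfolding e_def by simp
qed

lemma self_distancing_closure: "self_distancing (closure \<sigma>) closure_order"
proof -
  have sub: "\<sigma> \<subseteq> closure \<sigma>" by (rule closure_subset)
  have "trans closure_order"
    using transD[OF r_trans] r_carrier sub unfolding closure_order_def trans_def by blast
  moreover have "antisym closure_order"
    using antisymD[OF r_antisym] r_carrier new_limit_unique unfolding closure_order_def antisym_def by blast
  moreover have "total_on (closure \<sigma>) closure_order"
    using r_total unfolding closure_order_def total_on_def by blast
  moreover have "refl_on (closure \<sigma>) closure_order"
    using r_refl unfolding closure_order_def refl_on_def by blast
  moreover have "closure_order \<subseteq> closure \<sigma> \<times> closure \<sigma>"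
    using r_carrier sub unfolding closure_order_def by auto
  moreover have "norm (y - x) \<le> norm (z - x)"
    if xy: "(x, y) \<in> closure_order" and yz: "(y, z) \<in> closure_order" for x y z
  proof (cases "z \<in> \<sigma>")
    case True
    then have "(y, z) \<in> r" using yz unfolding closure_order_def by blast
    moreover then have "(x, y) \<in> r" using xy r_carrier unfolding closure_order_def by blast
    ultimately show ?thesis using dist_mono by blast
  next
    case False
    then have z: "z \<in> closure \<sigma> - \<sigma>" using yz r_carrier unfolding closure_order_def by blast
    show ?thesis
    proof (cases "y \<in> \<sigma>")
      case True
      then have xyr: "(x, y) \<in> r" using xy unfolding closure_order_def by blast
      show ?thesis
      proof (rule field_le_epsilon)
        fix e :: real assume "e > 0"
        then obtain w where w: "w \<in> \<sigma>" "norm (w - z) < e" "(y, w) \<in> r"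
          using near_limit_late[OF cl[OF True] True z] by blast
        have "norm (w - x) \<le> norm (z - x) + norm (w - z)"
          using norm_triangle_ineq[of "z - x" "w - z"] by simp
        then show "norm (y - x) \<le> norm (z - x) + e" using dist_mono[OF xyr w(3)] w(2) by simp
      qed
    next
      case False
      then have "y \<in> closure \<sigma> - \<sigma>" using xy r_carrier unfolding closure_order_def by blast
      then show ?thesis using new_limit_unique[OF z] by simp
    qed
  qed
  moreover have "bounded (closure \<sigma>)" using bdd by (rule bounded_closure)
  ultimately show ?thesis unfolding self_distancing_def order_on_defs by blast
qed

text \<open>A polygon that ends in the new limit point \<open>z\<close> is approximated by polygons that end in points of \<open>\<sigma>\<close>
  near \<open>z\<close>, which come after all other vertices.\<close>
lemma curve_length_closure_le: "curve_length closure_order (closure \<sigma>) \<le> curve_length r \<sigma>"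
  unfolding curve_length_eq[of closure_order]
proof (rule SUP_least)
  interpret c: self_distancing_set "closure \<sigma>" closure_order by standard (rule self_distancing_closure)
  fix xs assume xs: "xs \<in> chains closure_order (closure \<sigma>)"
  have into_r: "(x, y) \<in> r" if "(x, y) \<in> closure_order" "y \<in> \<sigma>" for x y
    using that unfolding closure_order_def by blast
  show "ennreal (polygon_length xs) \<le> curve_length r \<sigma>"
  proof (cases "set xs \<subseteq> \<sigma>")
    case True
    then have "xs \<in> chains r \<sigma>"
      using xs chains_mono[of "set xs" \<sigma> closure_order r] into_r by (auto simp: chains_def)
    then show ?thesis by (rule chain_le_curve_length)
  next
    case False
    then obtain z where z: "z \<in> closure \<sigma> - \<sigma>" "z \<in> set xs" using xs by (auto simp: chains_def)
    define ys where "ys = filter (\<lambda>x. x \<noteq> z) xs"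
    have "polygon_length xs \<le> polygon_length (xs @ [z])" using polygon_length_insert[of xs "[]" z] by simp
    also have "\<dots> = polygon_length (ys @ [z])" unfolding ys_def
      by (rule polygon_length_drop_endpoint[OF _ _ c.r_antisym])
         (use xs z in \<open>auto simp: chains_def closure_order_def\<close>)
    finally have le: "polygon_length xs \<le> polygon_length (ys @ [z])" .
    have yss: "set ys \<subseteq> \<sigma>" using xs new_limit_unique[OF z(1)] by (auto simp: ys_def chains_def)
    have "ys \<in> chains closure_order (set ys)"
      using xs by (auto simp: ys_def chains_def sorted_wrt_filter)
    then have ys: "ys \<in> chains r \<sigma>"
      using chains_mono[of "set ys" \<sigma> closure_order r] into_r yss by blast
    show ?thesis
    proof (cases "ys = []")
      case True
      then have "polygon_length xs = 0" using le polygon_length_nonneg[of xs] by simp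
      then show ?thesis by simp
    next
      case False
      define q where "q = last ys"
      have q: "q \<in> set ys" "ys = butlast ys @ [q]" using False by (auto simp: q_def)
      have yq: "y = q \<or> (y, q) \<in> r" if "y \<in> set ys" for y
        using ys that q(2) by (metis Un_iff chains_append empty_iff list.set(1) set_ConsD set_append list.set_intros(1))
      show ?thesis
      proof (rule ennreal_le_epsilon)
        fix e :: real assume "0 < e"
        then obtain x where x: "x \<in> \<sigma>" "norm (x - z) < e" "(q, x) \<in> r"
          using near_limit_late[OF cl _ z(1), of q e] q(1) yss by blast
        have "ys @ [x] \<in> chains r \<sigma>"
          using ys x yq transD[OF r_trans] unfolding chains_append by auto
        then have "ennreal (polygon_length (ys @ [x])) \<le> curve_length r \<sigma>" by (rule chain_le_curve_length)
        moreover have "polygon_length xs \<le> polygon_length (ys @ [x]) + e"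
        proof -
          have "norm (z - q) \<le> norm (x - q) + norm (x - z)"
            using norm_triangle_ineq4[of "x - q" "x - z"] by simp
          then show ?thesis using le x(2) polygon_length_snoc[OF False] unfolding q_def by simp
        qed
        then have "ennreal (polygon_length xs) \<le> ennreal (polygon_length (ys @ [x])) + ennreal e"
          using \<open>0 < e\<close> by (simp flip: ennreal_plus add: ennreal_leI)
        ultimately show "ennreal (polygon_length xs) \<le> curve_length r \<sigma> + ennreal e"
          by (meson add_right_mono order_trans)
      qed
    qed
  qed
qed

end

end

section \<open>The joined curve\<close>
lemma index_set_downward: "\<lbrakk>n \<in> index_set N; 1 \<le> m; m \<le> n\<rbrakk> \<Longrightarrow> m \<in> index_set N"
  unfolding index_set_def using order_trans[of "enat m" "enat n" N] by simp

locale joinable_components = self_distancing_set \<sigma> r for \<sigma> r +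
  fixes N :: enat and S :: "nat \<Rightarrow> plane set"
  assumes comps: "ordered_components \<sigma> r N S"
    and nonempty: "1 \<in> index_set N"
    and away: "\<lbrakk>i \<in> index_set N; Suc i \<in> index_set N; \<nexists>p. S (Suc i) = {p}\<rbrakk> \<Longrightarrow>
      (\<Union>j\<in>{1..i}. S j) \<subseteq> \<HH> r (S (Suc i)) (first_point r (S (Suc i)))"
    and normal: "\<lbrakk>i \<in> index_set N; Suc i \<in> index_set N\<rbrakk> \<Longrightarrow>
      first_point r (S (Suc i)) \<in> (\<lambda>v. last_point r (S i) + v) `
        normal_cone (convex hull (\<Union>j\<in>{1..i}. S j)) (last_point r (S i))"
begin

lemma component:
  assumes "i \<in> index_set N"
  shows "S i \<in> components \<sigma>" "S i \<subseteq> \<sigma>" "S i \<noteq> {}" "connected (S i)" "compact (S i)"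
proof -
  show c: "S i \<in> components \<sigma>" using comps assms unfolding ordered_components_def bij_betw_def by blast
  show sub: "S i \<subseteq> \<sigma>" "S i \<noteq> {}" "connected (S i)"
    using c in_components_subset in_components_nonempty in_components_connected by blast+
  have "closed (S i)" using comps assms unfolding ordered_components_def by blast
  then show "compact (S i)" using sub(1) bdd bounded_subset compact_eq_bounded_closed by blast
qed

lemma component_order: "\<lbrakk>i \<in> index_set N; j \<in> index_set N; i < j; x \<in> S i; y \<in> S j\<rbrakk> \<Longrightarrow> (x, y) \<in> r"
  using comps unfolding ordered_components_def by blast

lemma Union_S: "(\<Union>i\<in>index_set N. S i) = \<sigma>"
  using comps Union_components[of \<sigma>] unfolding ordered_components_def bij_betw_def by simp

abbreviation exit_point :: "nat \<Rightarrow> plane" where "exit_point i \<equiv> last_point r (S i)"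
abbreviation entry_point :: "nat \<Rightarrow> plane" where "entry_point i \<equiv> first_point r (S i)"
abbreviation gap :: "nat \<Rightarrow> plane set" where "gap i \<equiv> closed_segment (exit_point i) (entry_point (Suc i))"
abbreviation union_upto :: "nat \<Rightarrow> plane set" where "union_upto i \<equiv> \<Union>j\<in>{1..i}. S j"

lemma exit_point: "i \<in> index_set N \<Longrightarrow> exit_point i \<in> S i" "\<lbrakk>i \<in> index_set N; x \<in> S i\<rbrakk> \<Longrightarrow> (x, exit_point i) \<in> r"
  and entry_point: "i \<in> index_set N \<Longrightarrow> entry_point i \<in> S i" "\<lbrakk>i \<in> index_set N; x \<in> S i\<rbrakk> \<Longrightarrow> (entry_point i, x) \<in> r"
  using last_point first_point component by metis+

lemma union_upto_Suc: "union_upto (Suc n) = union_upto n \<union> S (Suc n)"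
  by (auto simp: atLeastAtMostSuc_conv)

lemma S_subset_union_upto: "\<lbrakk>1 \<le> i; i \<le> n\<rbrakk> \<Longrightarrow> S i \<subseteq> union_upto n"
  by (rule UN_upper) simp

lemma index_pos: "i \<in> index_set N \<Longrightarrow> 1 \<le> i"
  by (simp add: index_set_def)

lemma union_upto_subset: "n \<in> index_set N \<Longrightarrow> union_upto n \<subseteq> \<sigma>"
  using index_set_downward component(2) by fastforce

abbreviation inner_order :: "nat \<Rightarrow> plane rel" where "inner_order i \<equiv> r \<inter> S i \<times> S i"

text \<open>Stages are counted from 0 and components from 1: stage \<open>n\<close> joins the components \<open>1, \<dots>, Suc n\<close>.\<close>
primrec stage :: "nat \<Rightarrow> plane set" where
  "stage 0 = S 1"
| "stage (Suc n) = (stage n \<union> gap (Suc n)) \<union> S (Suc (Suc n))"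

primrec stage_order :: "nat \<Rightarrow> plane rel" where
  "stage_order 0 = inner_order 1"
| "stage_order (Suc n) =
     glue (stage n \<union> gap (Suc n))
       (glue (stage n) (stage_order n) (gap (Suc n)) (segment_order (exit_point (Suc n)) (entry_point (Suc (Suc n)))))
       (S (Suc (Suc n))) (inner_order (Suc (Suc n)))"

lemma stage_mono: "m \<le> n \<Longrightarrow> stage m \<subseteq> stage n"
  by (rule lift_Suc_mono_le[of stage]) auto

lemma stage_order_mono: "m \<le> n \<Longrightarrow> stage_order m \<subseteq> stage_order n"
  by (rule lift_Suc_mono_le[of stage_order]) (auto simp: glue_def)

lemma stage_eq: "stage n = union_upto (Suc n) \<union> (\<Union>i\<in>{1..n}. gap i)"
  by (induction n) (auto simp: union_upto_Suc atLeastAtMostSuc_conv)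

lemma gap_order_in_stage: "\<lbrakk>1 \<le> i; i \<le> n\<rbrakk> \<Longrightarrow> segment_order (exit_point i) (entry_point (Suc i)) \<subseteq> stage_order n"
proof (induction n)
  case (Suc n)
  then show ?case
    by (cases "i = Suc n") (auto simp: glue_def)
qed simp

lemma later_stage_later:
  "\<lbrakk>x \<in> stage m; y \<in> stage n; n \<le> m\<rbrakk> \<Longrightarrow> x \<in> stage n \<or> (y, x) \<in> stage_order m"
proof (induction m)
  case (Suc m)
  show ?case
  proof (cases "n = Suc m")
    case False
    then have "n \<le> m" "y \<in> stage m" using Suc.prems stage_mono[of n m] by auto
    then show ?thesis using Suc by (auto simp: glue_def)
  qed (use Suc.prems in simp)
qed simp

text \<open>The restriction of \<open>r\<close> to the components in stage \<open>n\<close> belongs to the order of that stage.\<close>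
lemma order_in_stage:
  assumes "Suc n \<in> index_set N" "(x, y) \<in> r" "x \<in> union_upto (Suc n)" "y \<in> union_upto (Suc n)"
  shows "(x, y) \<in> stage_order n"
  using assms
proof (induction n arbitrary: x y)
  case 0
  then show ?case by simp
next
  case (Suc n)
  have n: "Suc n \<in> index_set N" using index_set_downward[OF Suc.prems(1)] by simp
  have IH: "(x, y) \<in> stage_order (Suc n)" if "(x, y) \<in> r" "x \<in> union_upto (Suc n)" "y \<in> union_upto (Suc n)" for x y
    using Suc.IH[OF n that] stage_order_mono[of n "Suc n"] by auto
  have sub: "union_upto (Suc n) \<subseteq> stage n" by (auto simp: stage_eq)
  from Suc.prems(3,4) consider "x \<in> union_upto (Suc n)" "y \<in> union_upto (Suc n)" | "x \<in> union_upto (Suc n)" "y \<in> S (Suc (Suc n))"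
    | "x \<in> S (Suc (Suc n))" "y \<in> S (Suc (Suc n))" | "x \<in> S (Suc (Suc n))" "y \<in> union_upto (Suc n)"
    unfolding union_upto_Suc[of "Suc n"] by blast
  then show ?case
  proof cases
    case 1
    then show ?thesis using IH Suc.prems by blast
  next
    case 2
    then show ?thesis using sub by (auto simp: glue_def)
  next
    case 3
    then show ?thesis using Suc.prems by (auto simp: glue_def)
  next
    case 4
    then obtain j where j: "j \<in> {1..Suc n}" "y \<in> S j" by blast
    then have "j \<in> index_set N" using index_set_downward[OF n] by simp
    then have "(y, x) \<in> r" using component_order[of j "Suc (Suc n)" y x] j 4 Suc.prems(1) by simp
    then have "x = y" using Suc.prems(2) antisymD[OF r_antisym] by blast
    then show ?thesis using IH[of y y] 4 Suc.prems(2) by simp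
  qed
qed

text \<open>The invariant of the construction. The hull bound is what brings the normal cone and \<open>\<HH>\<close> into play
  at the next gluing, and the length bound is the one that minimality needs.\<close>
definition stage_ok :: "nat \<Rightarrow> bool" where
  "stage_ok n \<longleftrightarrow> self_distancing (stage n) (stage_order n) \<and> compact (stage n) \<and> connected (stage n) \<and>
    exit_point (Suc n) \<in> stage n \<and> (\<forall>x\<in>stage n. (x, exit_point (Suc n)) \<in> stage_order n) \<and>
    stage n \<subseteq> convex hull (union_upto (Suc n)) \<and>
    curve_length (stage_order n) (stage n) \<le> curve_length r (union_upto (Suc n))"

lemma component_self_distancing: "i \<in> index_set N \<Longrightarrow> self_distancing (S i) (inner_order i)"
  using self_distancing_restrict[OF sd] component(2) by blast

lemma component_curve_length: "curve_length (inner_order i) (S i) = curve_length r (S i)"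
  by (rule curve_length_cong) auto

text \<open>Polygons with vertices in \<open>\<sigma>\<close> may jump from the last point of one component to the first point of the
  next, so they already account for the gap.\<close>
lemma length_union_upto_Suc_ge:
  assumes i: "i \<in> index_set N" "Suc i \<in> index_set N"
  shows "curve_length r (union_upto i) + ennreal (norm (entry_point (Suc i) - exit_point i)) + curve_length r (S (Suc i))
    \<le> curve_length r (union_upto (Suc i))"
proof -
  have i1: "1 \<le> i" using index_pos[OF i(1)] .
  let ?A = "union_upto (Suc i)"
  have Asub: "?A \<subseteq> \<sigma>" using union_upto_subset[OF i(2)] .
  have qu: "exit_point i \<in> union_upto i" using exit_point(1)[OF i(1)] i1 by auto
  have before: "(x, y) \<in> r" if "x \<in> union_upto i" "y \<in> S (Suc i)" for x y
    using that component_order[of _ "Suc i"] i(2) index_set_downward[OF i(1)] by fastforce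
  have uq: "(x, exit_point i) \<in> r" if x: "x \<in> union_upto i" for x
  proof -
    obtain j where j: "j \<in> {1..i}" "x \<in> S j" using x by blast
    show ?thesis
    proof (cases "j = i")
      case False
      then show ?thesis
        using component_order[of j i x "exit_point i"] j exit_point(1)[OF i(1)] i(1) index_set_downward[OF i(1), of j] by auto
    qed (use j exit_point(2)[OF i(1)] in simp)
  qed
  have "len ?A = len {x \<in> ?A. (x, exit_point i) \<in> r} + len {x \<in> ?A. (exit_point i, x) \<in> r}"
    using qu by (intro len_split Asub) (auto simp: union_upto_Suc)
  moreover have "union_upto i \<subseteq> {x \<in> ?A. (x, exit_point i) \<in> r}" using uq by (auto simp: union_upto_Suc)
  then have "len (union_upto i) \<le> len {x \<in> ?A. (x, exit_point i) \<in> r}" using Asub by (intro len_mono) auto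
  moreover have "insert (exit_point i) (S (Suc i)) \<subseteq> {x \<in> ?A. (exit_point i, x) \<in> r}"
    using qu before uq by (auto simp: union_upto_Suc)
  then have "len (insert (exit_point i) (S (Suc i))) \<le> len {x \<in> ?A. (exit_point i, x) \<in> r}" using Asub by (intro len_mono) auto
  moreover
  let ?B = "insert (exit_point i) (S (Suc i))"
  have Bsub: "?B \<subseteq> \<sigma>" using exit_point(1)[OF i(1)] component(2) i by blast
  have "len ?B = len {x \<in> ?B. (x, entry_point (Suc i)) \<in> r} + len {x \<in> ?B. (entry_point (Suc i), x) \<in> r}"
    using entry_point(1)[OF i(2)] by (intro len_split Bsub) auto
  moreover have "[exit_point i, entry_point (Suc i)] \<in> chains r {x \<in> ?B. (x, entry_point (Suc i)) \<in> r}"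
    using entry_point[OF i(2)] before[OF qu] by auto
  then have "norm (entry_point (Suc i) - exit_point i) \<le> len {x \<in> ?B. (x, entry_point (Suc i)) \<in> r}"
    using polygon_le_len[of "{x \<in> ?B. (x, entry_point (Suc i)) \<in> r}" "[exit_point i, entry_point (Suc i)]"] Bsub by auto
  moreover have "S (Suc i) \<subseteq> {x \<in> ?B. (entry_point (Suc i), x) \<in> r}" using entry_point(2)[OF i(2)] by auto
  then have "len (S (Suc i)) \<le> len {x \<in> ?B. (entry_point (Suc i), x) \<in> r}" using Bsub by (intro len_mono) auto
  ultimately have "len (union_upto i) + norm (entry_point (Suc i) - exit_point i) + len (S (Suc i)) \<le> len ?A" by linarith
  then have "ennreal (len (union_upto i) + norm (entry_point (Suc i) - exit_point i) + len (S (Suc i))) \<le> ennreal (len ?A)"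
    by (rule ennreal_leI)
  then show ?thesis
    using curve_length_finite[OF Asub] curve_length_finite[OF union_upto_subset[OF i(1)]]
      curve_length_finite[OF component(2)[OF i(2)]] len_nonneg by simp
qed

text \<open>For the points of earlier components this is the meaning of \<open>\<HH>\<close>, for the first point of the new
  component it is self-distancing, and it passes to the hull because the condition on \<open>a\<close> is convex.\<close>
lemma hull_distance_nondecreasing:
  assumes i: "i \<in> index_set N" "Suc i \<in> index_set N"
    and a: "a \<in> convex hull (insert (entry_point (Suc i)) (union_upto i))"
    and xy: "(x, y) \<in> r" "x \<in> S (Suc i)" "y \<in> S (Suc i)"
  shows "norm (x - a) \<le> norm (y - a)"
proof -
  have "norm (x - a) \<le> norm (y - a)" if "a \<in> union_upto i" for a
  proof (cases "\<exists>p. S (Suc i) = {p}")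
    case False
    then have "a \<in> \<HH> r (S (Suc i)) (entry_point (Suc i))" using away[OF i] that by blast
    then show ?thesis
      using distance_nondecreasing_of_\<HH>[of "S (Suc i)" a x y] component[OF i(2)] xy by blast
  qed (use xy in auto)
  moreover have "norm (x - entry_point (Suc i)) \<le> norm (y - entry_point (Suc i))" using dist_mono entry_point(2)[OF i(2)] xy by blast
  ultimately have "insert (entry_point (Suc i)) (union_upto i) \<subseteq> {a. norm (x - a) \<le> norm (y - a)}" by blast
  then have "convex hull (insert (entry_point (Suc i)) (union_upto i)) \<subseteq> {a. norm (x - a) \<le> norm (y - a)}"
    by (rule hull_minimal) (rule convex_no_farther)
  then show ?thesis using a by blast
qed

text \<open>Two gluings: the segment is attached by the normal cone condition, and the next component by
  \<open>hull_distance_nondecreasing\<close>, since the segment lies in the hull of the earlier components and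
  the first point of the new one.\<close>
lemma stage_ok_step:
  assumes n: "Suc (Suc n) \<in> index_set N" and ok: "stage_ok n"
  shows "stage_ok (Suc n)"
proof -
  let ?i = "Suc n" and ?j = "Suc (Suc n)"
  let ?G = "gap ?i" and ?g = "segment_order (exit_point ?i) (entry_point ?j)"
  let ?A1 = "stage n \<union> ?G" and ?r1 = "glue (stage n) (stage_order n) (gap (Suc n)) (segment_order (exit_point (Suc n)) (entry_point (Suc (Suc n))))"
  have i: "?i \<in> index_set N" using index_set_downward[OF n] by simp
  have ok': "self_distancing (stage n) (stage_order n)" "compact (stage n)" "connected (stage n)"
    "exit_point ?i \<in> stage n" "\<And>x. x \<in> stage n \<Longrightarrow> (x, exit_point ?i) \<in> stage_order n"
    "stage n \<subseteq> convex hull (union_upto ?i)" "curve_length (stage_order n) (stage n) \<le> curve_length r (union_upto ?i)"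
    using ok unfolding stage_ok_def by auto
  have cone: "(entry_point ?j - exit_point ?i) \<bullet> (y - exit_point ?i) \<le> 0" if "y \<in> convex hull (union_upto ?i)" for y
    using normal[OF i n] that unfolding normal_cone_def by auto
  interpret g1: gluable "stage n" "stage_order n" ?G ?g "exit_point ?i"
  proof (unfold_locales, rule ok'(1), rule self_distancing_segment)
    show "(exit_point ?i, y) \<in> ?g" if "y \<in> ?G" for y using that by (simp add: segment_order_def)
    show "norm (y - x) \<le> norm (z - x)" if "x \<in> stage n" "(y, z) \<in> ?g" for x y z
      using distance_nondecreasing_along_segment[OF cone that(2)] that(1) ok'(6) by blast
  qed (use ok'(4,5) in auto)
  have lastp: "(x, entry_point ?j) \<in> ?r1" if "x \<in> ?A1" for x
    using that segment_bound(1)[of x "exit_point ?i" "entry_point ?j"] by (auto simp: glue_def segment_order_def)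
  have A1hull: "?A1 \<subseteq> convex hull (insert (entry_point ?j) (union_upto ?i))"
  proof -
    have "stage n \<subseteq> convex hull (insert (entry_point ?j) (union_upto ?i))"
      using ok'(6) hull_mono[of "union_upto ?i" "insert (entry_point ?j) (union_upto ?i)"] by blast
    moreover have "exit_point ?i \<in> union_upto ?i" using exit_point(1)[OF i] by auto
    then have "?G \<subseteq> convex hull (insert (entry_point ?j) (union_upto ?i))"
      by (intro closed_segment_subset_convex_hull) (auto intro: hull_inc)
    ultimately show ?thesis by blast
  qed
  interpret g2: gluable ?A1 ?r1 "S ?j" "inner_order ?j" "entry_point ?j"
  proof (unfold_locales, rule g1.self_distancing_glue, rule component_self_distancing[OF n])
    show "(entry_point ?j, y) \<in> inner_order ?j" if "y \<in> S ?j" for y using entry_point[OF n] that by auto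
    show "norm (y - x) \<le> norm (z - x)" if "x \<in> ?A1" "(y, z) \<in> inner_order ?j" for x y z
      using hull_distance_nondecreasing[OF i n, of x y z] A1hull that by blast
  qed (use lastp entry_point(1)[OF n] in auto)
  have "connected ?A1" using ok'(3,4) by (intro connected_Un) auto
  moreover have "entry_point ?j \<in> ?A1 \<inter> S ?j" using entry_point(1)[OF n] by simp
  ultimately have "connected (?A1 \<union> S ?j)" using connected_Un[OF _ component(4)[OF n], of ?A1] by blast
  then have "connected (stage (Suc n))" by simp
  moreover have "compact (stage (Suc n))" using ok'(2) component(5)[OF n] by (simp add: compact_Un)
  moreover have "(x, exit_point ?j) \<in> stage_order (Suc n)" if "x \<in> stage (Suc n)" for x
    using that exit_point[OF n] by (auto simp: glue_def)
  moreover have "exit_point ?j \<in> stage (Suc n)" using exit_point(1)[OF n] by simp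
  moreover have "stage (Suc n) \<subseteq> convex hull (union_upto ?j)"
  proof -
    have "insert (entry_point ?j) (union_upto ?i) \<subseteq> union_upto ?j" using entry_point(1)[OF n] union_upto_Suc[of ?i] by blast
    then have "?A1 \<subseteq> convex hull (union_upto ?j)" using A1hull hull_mono by blast
    moreover have "S ?j \<subseteq> convex hull (union_upto ?j)" by (rule order_trans[OF S_subset_union_upto hull_subset]) auto
    ultimately show ?thesis by simp
  qed
  moreover have "curve_length (stage_order (Suc n)) (stage (Suc n)) \<le> curve_length r (union_upto ?j)"
  proof -
    have "curve_length (stage_order (Suc n)) (stage (Suc n)) =
        curve_length (stage_order n) (stage n) + curve_length ?g ?G + curve_length r (S ?j)"
      using g2.curve_length_glue g1.curve_length_glue component_curve_length by simp
    also have "\<dots> \<le> curve_length r (union_upto ?i) + ennreal (norm (entry_point ?j - exit_point ?i)) + curve_length r (S ?j)"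
      by (intro add_mono ok'(7) curve_length_segment_le order_refl)
    also have "\<dots> \<le> curve_length r (union_upto ?j)" by (rule length_union_upto_Suc_ge[OF i n])
    finally show ?thesis .
  qed
  moreover have "self_distancing (stage (Suc n)) (stage_order (Suc n))"
    using g2.self_distancing_glue by simp
  ultimately show ?thesis unfolding stage_ok_def by blast
qed

lemma stage_ok: "Suc n \<in> index_set N \<Longrightarrow> stage_ok n"
proof (induction n)
  case 0
  have "union_upto (Suc 0) = S 1" by simp
  then show ?case
    using component[OF nonempty] component_self_distancing[OF nonempty] exit_point[OF nonempty] hull_subset[of "S 1" convex]
      component_curve_length[of 1] unfolding stage_ok_def by auto
next
  case (Suc n)
  then show ?case using stage_ok_step index_set_downward[OF Suc.prems, of "Suc n"] by simp
qed

definition stage_indices :: "nat set" where "stage_indices = {n. Suc n \<in> index_set N}"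
definition joined :: "plane set" where "joined = (\<Union>n\<in>stage_indices. stage n)"
definition joined_order :: "plane rel" where "joined_order = (\<Union>n\<in>stage_indices. stage_order n)"

lemma stage_indices: "0 \<in> stage_indices" "n \<in> stage_indices \<Longrightarrow> stage_ok n" "\<lbrakk>n \<in> stage_indices; m \<le> n\<rbrakk> \<Longrightarrow> m \<in> stage_indices"
  using nonempty stage_ok index_set_downward[of "Suc n" N "Suc m"] by (auto simp: stage_indices_def)

lemma self_distancing_joined: "self_distancing joined joined_order"
  unfolding joined_def joined_order_def
proof (rule self_distancing_directed_Union)
  show "stage_indices \<noteq> {}" using stage_indices(1) by blast
  show "self_distancing (stage n) (stage_order n)" if "n \<in> stage_indices" for n using stage_indices(2)[OF that] by (simp add: stage_ok_def)
  show "stage m \<subseteq> stage n \<and> stage_order m \<subseteq> stage_order n" if "m \<le> n" "n \<in> stage_indices" for m n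
    using stage_mono stage_order_mono that by blast
  have "stage n \<subseteq> convex hull \<sigma>" if "n \<in> stage_indices" for n
    using stage_indices(2)[OF that] hull_mono[OF union_upto_subset, of "Suc n" convex] that unfolding stage_ok_def stage_indices_def by blast
  then have "(\<Union>n\<in>stage_indices. stage n) \<subseteq> convex hull \<sigma>" by blast
  moreover have "bounded (convex hull \<sigma>)" using bdd by (rule bounded_convex_hull)
  ultimately show "bounded (\<Union>n\<in>stage_indices. stage n)" by (rule bounded_subset[rotated])
qed

sublocale j: self_distancing_set joined joined_order
  by standard (rule self_distancing_joined)

lemma stage_subset_joined: "n \<in> stage_indices \<Longrightarrow> stage n \<subseteq> joined" "n \<in> stage_indices \<Longrightarrow> stage_order n \<subseteq> joined_order"
  unfolding joined_def joined_order_def by blast+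

text \<open>Every stage is an initial segment of the joined curve; as stages are compact, this makes initial
  segments of the joined curve closed.\<close>
lemma joined_initial:
  assumes "n \<in> stage_indices" "y \<in> stage n" "(x, y) \<in> joined_order"
  shows "x \<in> stage n"
proof -
  obtain m where m: "m \<in> stage_indices" "x \<in> stage m" using j.r_carrier[OF assms(3)] unfolding joined_def by blast
  show ?thesis
  proof (cases "n \<le> m")
    case True
    then have "x \<in> stage n \<or> (y, x) \<in> joined_order"
      using later_stage_later[OF m(2) assms(2)] stage_subset_joined(2)[OF m(1)] by blast
    then show ?thesis using assms(2,3) antisymD[OF j.r_antisym] by blast
  qed (use m stage_mono[of m n] in auto)
qed

lemma joined_order_on_stage:
  assumes "n \<in> stage_indices" "x \<in> stage n" "y \<in> stage n"
  shows "(x, y) \<in> joined_order \<longleftrightarrow> (x, y) \<in> stage_order n"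
proof
  interpret s: self_distancing_set "stage n" "stage_order n"
    by standard (use stage_indices(2)[OF assms(1)] in \<open>simp add: stage_ok_def\<close>)
  show "(x, y) \<in> stage_order n" if "(x, y) \<in> joined_order"
    using s.r_total[OF assms(2,3)] that stage_subset_joined(2)[OF assms(1)] antisymD[OF j.r_antisym, of x y]
      s.r_refl[OF assms(2)] by blast
qed (use stage_subset_joined(2)[OF assms(1)] in blast)

lemma joined_closed_below:
  assumes "y \<in> joined" shows "closed {x \<in> joined. (x, y) \<in> joined_order}"
proof -
  obtain n where n: "n \<in> stage_indices" "y \<in> stage n" using assms unfolding joined_def by blast
  have "closed (stage n)" using stage_indices(2)[OF n(1)] compact_imp_closed by (auto simp: stage_ok_def)
  then have "closed {x \<in> stage n. (x, y) \<in> joined_order}"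
    using j.closed_below stage_subset_joined(1)[OF n(1)] assms by blast
  moreover have "{x \<in> joined. (x, y) \<in> joined_order} = {x \<in> stage n. (x, y) \<in> joined_order}"
    using joined_initial[OF n] stage_subset_joined(1)[OF n(1)] by blast
  ultimately show ?thesis by simp
qed

text \<open>The finitely many vertices of a polygon lie in a common stage.\<close>
lemma curve_length_joined_le: "curve_length joined_order joined \<le> curve_length r \<sigma>"
  unfolding curve_length_eq[of joined_order]
proof (rule SUP_least)
  fix xs assume xs: "xs \<in> chains joined_order joined"
  have "\<exists>n\<in>stage_indices. F \<subseteq> stage n" if "finite F" "F \<subseteq> joined" for F
    using that
  proof (induction F)
    case (insert x F)
    then obtain m n where "m \<in> stage_indices" "F \<subseteq> stage m" "n \<in> stage_indices" "x \<in> stage n" unfolding joined_def by auto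
    then show ?case using stage_mono[of m n] stage_mono[of n m] by (cases "m \<le> n") auto
  qed (use stage_indices(1) in blast)
  then obtain n where n: "n \<in> stage_indices" "set xs \<subseteq> stage n" using xs unfolding chains_def by blast
  have "xs \<in> chains joined_order (set xs)" using xs by (simp add: chains_def)
  then have "xs \<in> chains (stage_order n) (stage n)"
    using chains_mono[OF n(2), of joined_order "stage_order n"] joined_order_on_stage[OF n(1)] n(2) by blast
  then have "ennreal (polygon_length xs) \<le> curve_length (stage_order n) (stage n)" by (rule chain_le_curve_length)
  also have "\<dots> \<le> curve_length r (union_upto (Suc n))" using stage_indices(2)[OF n(1)] by (simp add: stage_ok_def)
  also have "\<dots> \<le> curve_length r \<sigma>"
    by (rule curve_length_mono) (use union_upto_subset n(1) in \<open>auto simp: stage_indices_def\<close>)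
  finally show "ennreal (polygon_length xs) \<le> curve_length r \<sigma>" .
qed

lemma joined_curve_eq: "joined_curve r N S = closure joined"
proof -
  have "(\<Union>i\<in>index_set N. S i) \<union> (\<Union>i\<in>{i \<in> index_set N. Suc i \<in> index_set N}. gap i) = joined" (is "?L = _")
  proof
    have "S i \<subseteq> joined" if "i \<in> index_set N" for i
    proof -
      have "i = Suc (i - 1)" using index_pos[OF that] by simp
      then have "i - 1 \<in> stage_indices" "S i \<subseteq> stage (i - 1)"
        using that S_subset_union_upto[of i i] index_pos[OF that] stage_eq[of "i - 1"] by (auto simp: stage_indices_def)
      then show ?thesis using stage_subset_joined(1) by blast
    qed
    moreover have "gap i \<subseteq> joined" if "i \<in> index_set N" "Suc i \<in> index_set N" for i
    proof -
      have "i \<in> {1..i}" "i \<in> stage_indices" using that index_pos by (auto simp: stage_indices_def)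
      then show ?thesis using stage_subset_joined(1)[of i] unfolding stage_eq by blast
    qed
    ultimately show "?L \<subseteq> joined" by blast
    have "stage n \<subseteq> ?L" if "n \<in> stage_indices" for n
    proof -
      have "i \<in> index_set N" if "1 \<le> i" "i \<le> Suc n" for i
        using index_set_downward[of "Suc n" N i] that \<open>n \<in> stage_indices\<close> by (simp add: stage_indices_def)
      then show ?thesis unfolding stage_eq by fastforce
    qed
    then show "joined \<subseteq> ?L" unfolding joined_def by blast
  qed
  then show ?thesis unfolding joined_curve_def by simp
qed

lemma sigma_subset_joined: "\<sigma> \<subseteq> joined" "r \<subseteq> joined_order"
proof -
  have up: "\<exists>n. n \<in> stage_indices \<and> x \<in> union_upto (Suc n)" if "x \<in> \<sigma>" for x
  proof -
    have "x \<in> (\<Union>i\<in>index_set N. S i)" using that Union_S by simp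
    then obtain i where i: "i \<in> index_set N" "x \<in> S i" by blast
    then have "Suc (i - 1) = i" "x \<in> union_upto i" using index_pos S_subset_union_upto[of i i] by auto
    then show ?thesis using i(1) by (intro exI[of _ "i - 1"]) (simp add: stage_indices_def)
  qed
  show "\<sigma> \<subseteq> joined"
  proof
    fix x assume "x \<in> \<sigma>"
    from up[OF this] obtain n where "n \<in> stage_indices" and n: "x \<in> union_upto (Suc n)" by (elim exE conjE) (rule that)
    from n have "x \<in> stage n" unfolding stage_eq by (rule UnI1)
    then show "x \<in> joined" using stage_subset_joined(1)[OF \<open>n \<in> stage_indices\<close>] by blast
  qed
  show "r \<subseteq> joined_order"
  proof clarify
    fix x y assume xy: "(x, y) \<in> r"
    obtain m where m: "m \<in> stage_indices" "x \<in> union_upto (Suc m)" using up[of x] r_carrier[OF xy] by auto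
    obtain n where n: "n \<in> stage_indices" "y \<in> union_upto (Suc n)" using up[of y] r_carrier[OF xy] by auto
    let ?k = "max m n"
    have k: "?k \<in> stage_indices" using m n by (simp add: max_def)
    have "union_upto (Suc m) \<subseteq> union_upto (Suc ?k)" "union_upto (Suc n) \<subseteq> union_upto (Suc ?k)" by (intro UN_mono; simp)+
    note this[THEN subsetD]
    then have "x \<in> union_upto (Suc ?k)" "y \<in> union_upto (Suc ?k)" using m(2) n(2) by simp_all
    then have "(x, y) \<in> stage_order ?k" using order_in_stage[of ?k x y] xy k by (simp add: stage_indices_def)
    then show "(x, y) \<in> joined_order" using stage_subset_joined(2)[OF k] by blast
  qed
qed

lemma joined_curve_minimal_extension:
  assumes "\<nexists>x. \<sigma> \<subseteq> {x}"
  shows "(joined_curve r N S, j.closure_order) \<in> sdc_extensions \<sigma> r"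
    and "\<lbrakk>i \<in> index_set N; Suc i \<in> index_set N\<rbrakk> \<Longrightarrow> runs_along_segment j.closure_order (exit_point i) (entry_point (Suc i))"
    and "(\<gamma>, s) \<in> sdc_extensions \<sigma> r \<Longrightarrow>
      curve_length j.closure_order (joined_curve r N S) \<le> curve_length s \<gamma>"
proof -
  have sdc: "self_distancing (closure joined) j.closure_order"
    by (rule j.self_distancing_closure) (rule joined_closed_below)
  have sub: "\<sigma> \<subseteq> closure joined" using sigma_subset_joined(1) closure_subset by blast
  have ord: "joined_order \<subseteq> j.closure_order" by (auto simp: j.closure_order_def)
  have "connected joined" unfolding joined_def
  proof (rule connected_Union)
    show "connected A" if "A \<in> stage ` stage_indices" for A using stage_indices(2) that by (auto simp: stage_ok_def)
    have "S 1 \<subseteq> stage n" for n using stage_mono[of 0 n] by simp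
    then show "\<Inter> (stage ` stage_indices) \<noteq> {}" using component(3)[OF nonempty] by blast
  qed
  then have "connected (closure joined)" by (rule connected_imp_connected_closure)
  moreover have "\<nexists>x. closure joined \<subseteq> {x}" using assms sub by blast
  ultimately show "(joined_curve r N S, j.closure_order) \<in> sdc_extensions \<sigma> r"
    using sdc sub sigma_subset_joined(2) ord
    unfolding joined_curve_eq sdc_extensions_def sdc_def by auto
  show "runs_along_segment j.closure_order (exit_point i) (entry_point (Suc i))" if "i \<in> index_set N" "Suc i \<in> index_set N"
  proof (rule runs_along_segment_if_segment_order)
    show "linear_order_on (closure joined) j.closure_order" using sdc by (simp add: self_distancing_def)
    have "segment_order (exit_point i) (entry_point (Suc i)) \<subseteq> stage_order i"
      using gap_order_in_stage[of i i] that by (simp add: index_set_def)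
    then show "segment_order (exit_point i) (entry_point (Suc i)) \<subseteq> j.closure_order"
      using stage_subset_joined(2)[of i] that ord by (auto simp: stage_indices_def)
  qed
  show "curve_length j.closure_order (joined_curve r N S) \<le> curve_length s \<gamma>" if "(\<gamma>, s) \<in> sdc_extensions \<sigma> r"
  proof -
    have "curve_length j.closure_order (joined_curve r N S) \<le> curve_length joined_order joined"
      unfolding joined_curve_eq by (rule j.curve_length_closure_le) (rule joined_closed_below)
    also have "\<dots> \<le> curve_length r \<sigma>" by (rule curve_length_joined_le)
    also have "\<dots> \<le> curve_length s \<gamma>"
      by (rule curve_length_mono) (use that in \<open>auto simp: sdc_extensions_def\<close>)
    finally show ?thesis .
  qed
qed

end

text \<open>Any segment that starts in the point will do.\<close>
lemma sdc_extension_of_subsingleton: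
  assumes "self_distancing \<sigma> r" "\<sigma> \<subseteq> {x}"
  shows "sdc_extensions \<sigma> r \<noteq> {}"
proof -
  let ?y = "x + axis 1 1"
  have "?y \<noteq> x" by simp
  moreover have "{x, ?y} \<subseteq> closed_segment x ?y" by simp
  ultimately have "\<not> closed_segment x ?y \<subseteq> {z}" for z
  proof -
    have "\<not> {x, ?y} \<subseteq> {z}" using \<open>?y \<noteq> x\<close> by blast
    then show ?thesis using \<open>{x, ?y} \<subseteq> closed_segment x ?y\<close> by (meson order_trans)
  qed
  then have "sdc (closed_segment x ?y) (segment_order x ?y)"
    using self_distancing_segment[of x ?y] unfolding sdc_def by auto
  moreover have "r \<subseteq> \<sigma> \<times> \<sigma>" using assms(1) unfolding self_distancing_def order_on_defs by blast
  then have "r \<subseteq> segment_order x ?y" using assms(2) by (auto simp: segment_order_def)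
  ultimately have "(closed_segment x ?y, segment_order x ?y) \<in> sdc_extensions \<sigma> r"
    using assms(2) by (auto simp: sdc_extensions_def)
  then show ?thesis by blast
qed

theorem theorem5p9:
  fixes \<sigma> :: "plane set" and r :: "plane rel" and N :: enat and S :: "nat \<Rightarrow> plane set"
  assumes "ordered_components \<sigma> r N S"
    and "\<And>i. \<lbrakk>i \<in> index_set N; Suc i \<in> index_set N; \<nexists>p. S (Suc i) = {p}\<rbrakk> \<Longrightarrow>
           (\<Union>j\<in>{1..i}. S j) \<subseteq> \<HH> r (S (Suc i)) (first_point r (S (Suc i)))"
    and "\<And>i. \<lbrakk>i \<in> index_set N; Suc i \<in> index_set N\<rbrakk> \<Longrightarrow>
           first_point r (S (Suc i)) \<in>
             (\<lambda>v. last_point r (S i) + v) `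
               normal_cone (convex hull (\<Union>j\<in>{1..i}. S j)) (last_point r (S i))"
  shows "sdc_extensions \<sigma> r \<noteq> {} \<and>
    ((\<nexists>p. \<sigma> \<subseteq> {p}) \<longrightarrow>
      (\<exists>s. (joined_curve r N S, s) \<in> sdc_extensions \<sigma> r \<and>
           (\<forall>i. i \<in> index_set N \<and> Suc i \<in> index_set N \<longrightarrow>
              runs_along_segment s (last_point r (S i)) (first_point r (S (Suc i)))) \<and>
           (\<forall>(\<gamma>, s')\<in>sdc_extensions \<sigma> r.
              curve_length s (joined_curve r N S) \<le> curve_length s' \<gamma>)))"
proof (cases "\<exists>p. \<sigma> \<subseteq> {p}")
  case True
  then show ?thesis
    using assms(1) sdc_extension_of_subsingleton unfolding ordered_components_def by blast
next
  case False
  have sd: "self_distancing \<sigma> r" using assms(1) by (simp add: ordered_components_def)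
  have "\<sigma> \<noteq> {}" using False by blast
  then have "components \<sigma> \<noteq> {}" by (simp add: components_eq_empty)
  moreover have "S ` index_set N = components \<sigma>"
    using assms(1) by (simp add: ordered_components_def bij_betw_def)
  ultimately have "index_set N \<noteq> {}" by (metis image_empty)
  then obtain i where "i \<in> index_set N" by blast
  then have one: "1 \<in> index_set N" using index_set_downward[of i N 1] by (simp add: index_set_def)
  interpret joinable_components \<sigma> r N S
    by (unfold_locales; (fact sd | fact one | fact assms))
  show ?thesis using joined_curve_minimal_extension[OF False] False by blast
qed

end
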